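(* Let $\mathcal{G}$ be the family of $3$-regular simple graphs of order $10$, and let $P$ be the Petersen graph. Then: (i) $P$ is not $\mathcal{E}_{ESO}$-unique in $\mathcal{G}$, i.e. there is a graph $H\in\mathcal{G}$ not isomorphic to $P$ with $E_{ESO}(H)=E_{ESO}(P)$; (ii) $P$ has the maximum elliptic Sombor energy in $\mathcal{G}$, i.e. $E_{ESO}(H)\le E_{ESO}(P)$ for every $H\in\mathcal{G}$.
   Context: For a simple graph $G$ with vertex set $\{v_1,\ldots,v_n\}$, let $d_i$ denote the degree of $v_i$. The elliptic Sombor matrix $A_{ESO}(G)$ is the $n\times n$ real symmetric matrix whose $(i,j)$-entry is $(d_i+d_j)\sqrt{d_i^2+d_j^2}$ if $v_i$ and $v_j$ are adjacent, and $0$ otherwise. The elliptic Sombor energy is $E_{ESO}(G)=\sum_{i=1}^n|\lambda_i|$, where $\lambda_1,\ldots,\lambda_n$ are the eigenvalues of $A_{ESO}(G)$ counted with multiplicity. Graphs are considered up to isomorphism, and are not required to be connected. Two graphs are $\mathcal{E}_{ESO}$-equivalent if they have equal elliptic Sombor energy; a graph $G$ in a family of graphs is $\mathcal{E}_{ESO}$-unique in that family if its equivalence class within the family is $\{G\}$. *)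

theory Defs
  imports
    Complex_Main
    "Graph_Theory.Graph_Theory"
    "Jordan_Normal_Form.Char_Poly"
begin

text \<open>
  Finite simple graphs are the \<^locale>\<open>pair_graph\<close>s of the library: an undirected edge between
  \<open>u\<close> and \<open>v\<close> is the pair of arcs \<open>(u, v)\<close>, \<open>(v, u)\<close>, so the degree of \<open>v\<close> is its out-degree.
\<close>

definition degree_of :: "'a pair_pre_digraph \<Rightarrow> 'a \<Rightarrow> nat" where
  "degree_of G v = out_degree (with_proj G) v"

definition regular_graphs :: "nat \<Rightarrow> nat \<Rightarrow> 'a pair_pre_digraph set" where
  "regular_graphs k n =
    {G. pair_graph G \<and> card (pverts G) = n \<and> (\<forall>v\<in>pverts G. degree_of G v = k)}"

definition graph_iso :: "'a pair_pre_digraph \<Rightarrow> 'b pair_pre_digraph \<Rightarrow> bool" where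
  "graph_iso G H \<longleftrightarrow> digraph_iso (with_proj G) (with_proj H)"

definition eso_matrix :: "'a pair_pre_digraph \<Rightarrow> 'a list \<Rightarrow> real mat" where
  "eso_matrix G vs = mat (length vs) (length vs) (\<lambda>(i, j).
     let di = real (degree_of G (vs ! i)); dj = real (degree_of G (vs ! j))
     in if (vs ! i, vs ! j) \<in> parcs G then (di + dj) * sqrt (di\<^sup>2 + dj\<^sup>2) else 0)"

definition is_vertex_enum :: "'a pair_pre_digraph \<Rightarrow> 'a list \<Rightarrow> bool" where
  "is_vertex_enum G vs \<longleftrightarrow> distinct vs \<and> set vs = pverts G"

text \<open>The sum of the absolute values of the real eigenvalues, each counted as often as its
  algebraic multiplicity; a real symmetric matrix has no other eigenvalues.\<close>

definition matrix_energy :: "real mat \<Rightarrow> real" where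
  "matrix_energy A = (\<Sum>k | eigenvalue A k. real (order k (char_poly A)) * \<bar>k\<bar>)"

definition eso_energy :: "'a pair_pre_digraph \<Rightarrow> real" where
  "eso_energy G = matrix_energy (eso_matrix G (SOME vs. is_vertex_enum G vs))"

text \<open>The choice of the vertex enumeration is immaterial.\<close>

lemma similar_mat_eso_matrix:
  assumes vs: "is_vertex_enum G vs" and ws: "is_vertex_enum G ws"
  shows "similar_mat (eso_matrix G vs) (eso_matrix G ws)"
proof -
  define n where "n = length vs"
  have len: "length ws = n"
    using vs ws by (metis is_vertex_enum_def distinct_card n_def)
  have "\<exists>j<n. ws ! j = vs ! i" if "i < n" for i
    using that vs ws len by (metis is_vertex_enum_def n_def in_set_conv_nth)
  then obtain p where p: "\<And>i. i < n \<Longrightarrow> p i < n \<and> ws ! p i = vs ! i"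
    by metis
  have inj: "inj_on p {..<n}"
    using p vs by (auto simp: inj_on_def is_vertex_enum_def n_def)
      (metis nth_eq_iff_index_eq)
  define P :: "real mat" where "P = mat n n (\<lambda>(i, j). if p i = j then 1 else 0)"
  define Q :: "real mat" where "Q = mat n n (\<lambda>(i, j). if p j = i then 1 else 0)"
  let ?A = "eso_matrix G vs" and ?B = "eso_matrix G ws"
  have carr: "P \<in> carrier_mat n n" "Q \<in> carrier_mat n n" "?A \<in> carrier_mat n n"
    "?B \<in> carrier_mat n n"
    by (auto simp: P_def Q_def eso_matrix_def n_def len[unfolded n_def])
  have PQ: "P * Q = 1\<^sub>m n"
  proof (rule eq_matI)
    fix i j assume ij: "i < dim_row (1\<^sub>m n)" "j < dim_col (1\<^sub>m n)"
    then have "(P * Q) $$ (i, j) = (\<Sum>k\<in>{0..<n}. (if p i = k then 1 else 0) * (if p j = k then 1 else 0))"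
      by (simp add: P_def Q_def scalar_prod_def)
    also have "\<dots> = (\<Sum>k\<in>{0..<n}. if k = p i then (if p j = p i then 1 else 0) else 0)"
      by (rule sum.cong) auto
    also have "\<dots> = (if i = j then 1 else 0)"
      using p[of i] ij inj by (auto simp: inj_on_def)
    finally show "(P * Q) $$ (i, j) = (1\<^sub>m n) $$ (i, j)" using ij by simp
  qed (auto simp: P_def Q_def)
  then have QP: "Q * P = 1\<^sub>m n"
    using mat_mult_left_right_inverse carr by blast
  have "P * ?B * Q = ?A"
  proof (rule eq_matI)
    fix i j assume "i < dim_row ?A" "j < dim_col ?A"
    then have ij: "i < n" "j < n" by (auto simp: eso_matrix_def n_def)
    have PB: "(P * ?B) $$ (i, l) = ?B $$ (p i, l)" if l: "l < n" for l
    proof -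
      have "(P * ?B) $$ (i, l) = (\<Sum>k\<in>{0..<n}. (if p i = k then 1 else 0) * ?B $$ (k, l))"
        using ij l carr by (simp add: P_def scalar_prod_def)
      also have "\<dots> = (\<Sum>k\<in>{0..<n}. if k = p i then ?B $$ (p i, l) else 0)"
        by (rule sum.cong) auto
      finally show ?thesis using p[of i] ij by auto
    qed
    have "(P * ?B * Q) $$ (i, j) = (\<Sum>l\<in>{0..<n}. (P * ?B) $$ (i, l) * Q $$ (l, j))"
      using ij carr by (simp add: scalar_prod_def del: assoc_mult_mat)
    also have "\<dots> = (\<Sum>l\<in>{0..<n}. if l = p j then ?B $$ (p i, p j) else 0)"
      by (rule sum.cong) (use ij in \<open>auto simp: PB Q_def\<close>)
    also have "\<dots> = ?B $$ (p i, p j)" using p[of j] ij by auto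
    also have "\<dots> = ?A $$ (i, j)"
      using p[of i] p[of j] ij len by (simp add: eso_matrix_def n_def)
    finally show "(P * ?B * Q) $$ (i, j) = ?A $$ (i, j)" .
  qed (use carr in auto)
  then have "similar_mat_wit ?A ?B P Q"
    using carr PQ QP by (auto simp: similar_mat_wit_def Let_def)
  then show ?thesis unfolding similar_mat_def by blast
qed

lemma eso_energy_eq:
  assumes "is_vertex_enum G vs"
  shows "eso_energy G = matrix_energy (eso_matrix G vs)"
proof -
  define ws where "ws = (SOME vs. is_vertex_enum G vs)"
  have ws: "is_vertex_enum G ws" unfolding ws_def using assms by (rule someI)
  have cp: "char_poly (eso_matrix G ws) = char_poly (eso_matrix G vs)"
    by (rule char_poly_similar[OF similar_mat_eso_matrix[OF ws assms]])
  have "eigenvalue (eso_matrix G us) k \<longleftrightarrow> poly (char_poly (eso_matrix G us)) k = 0" for us k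
    by (rule eigenvalue_root_char_poly[where n = "length us"]) (simp add: eso_matrix_def)
  then show ?thesis
    by (simp add: eso_energy_def matrix_energy_def cp flip: ws_def)
qed

definition eso_equivalent :: "'a pair_pre_digraph \<Rightarrow> 'b pair_pre_digraph \<Rightarrow> bool" where
  "eso_equivalent G H \<longleftrightarrow> eso_energy G = eso_energy H"

text \<open>Graphs are taken up to isomorphism, so the class of \<open>G\<close> being \<open>{G}\<close> means that each of its
  members is isomorphic to \<open>G\<close>.\<close>

definition eso_unique :: "'a pair_pre_digraph set \<Rightarrow> 'a pair_pre_digraph \<Rightarrow> bool" where
  "eso_unique F G \<longleftrightarrow> (\<forall>H\<in>F. eso_equivalent H G \<longrightarrow> graph_iso H G)"

text \<open>The Petersen graph as the Kneser graph of the 2-subsets of a 5-set.\<close>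

definition petersen :: "nat set pair_pre_digraph" where
  "petersen = (let V = {S. S \<subseteq> {0..<5} \<and> card S = 2}
     in \<lparr> pverts = V, parcs = {(S, T). S \<in> V \<and> T \<in> V \<and> S \<inter> T = {}} \<rparr>)"

end

theory Submission
  imports Defs "Jordan_Normal_Form.Schur_Decomposition"
begin

text \<open>
  In a cubic graph all entries of the elliptic Sombor matrix equal \<open>eso_weight 3 = 18 * sqrt 2\<close>
  times those of the adjacency matrix \<open>A\<close>. It therefore suffices to compare the sums
  \<open>\<bar>x\<^sub>1\<bar> + \<dots> + \<bar>x\<^sub>1\<^sub>0\<bar>\<close> over the adjacency eigenvalues; for the Petersen graph, with spectrum
  \<open>3, 1\<^sup>5, (-2)\<^sup>4\<close>, this sum is \<open>16\<close>.

  The eigenvalues are accessible only through their power sums, which are traces of powers of \<open>A\<close>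
  and so count closed walks. The key is an even polynomial \<open>majorant a b\<close> of degree six that lies
  above \<open>\<bar>x\<bar>\<close> on the whole line and touches it exactly at \<open>\<plusminus>a\<close> and \<open>\<plusminus>b\<close>
  (\<open>majorant_minus_abs\<close>).
  Writing \<open>w\<^sub>k\<close> for the number of closed walks of length \<open>k\<close>, one has \<open>w\<^sub>2 = 30\<close>. Summing
  \<open>majorant 1 2\<close> over the nine eigenvalues other than the principal eigenvalue \<open>3\<close> shows that
  the sum of the \<open>\<bar>x\<^sub>i\<bar>\<close> is at most \<open>16\<close> as soon as \<open>w\<^sub>6 - 12 w\<^sub>4 \<le> -810\<close>. This bound is wasteful when
  \<open>\<plusminus>3\<close> occurs a second time, as in bipartite or disconnected graphs; there \<open>majorant 1 3\<close>, summed
  over all ten eigenvalues, gives the same conclusion from \<open>w\<^sub>6 - 23 w\<^sub>4 \<le> -2616\<close>.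

  Every cubic graph on ten vertices satisfies one of these two inequalities. This is verified by
  exhaustion: labelling the vertices in the order of a breadth-first search turns each such graph
  into a leaf of a search tree with 649 leaves (\<open>every_completion_complete\<close>), at each of which
  \<open>w\<^sub>4\<close> and \<open>w\<^sub>6\<close> are evaluated (\<open>every_cubic_adj_list\<close>).

  Equality holds when all eigenvalues but one \<open>3\<close> lie in \<open>{\<plusminus>1, \<plusminus>2}\<close>, the contact points of
  \<open>majorant 1 2\<close>. That is a condition on walk counts as well, because it says that
  \<open>(x\<^sup>2 - 1)\<^sup>2 (x\<^sup>2 - 4)\<^sup>2\<close> sums to its value \<open>1600\<close> at \<open>3\<close> (\<open>sum_abs_eq_16\<close>). The Petersen graph
  fulfils it, and so does a cubic graph with two triangles and no 4-cycle, with spectrum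
  \<open>3, 2, 1\<^sup>3, (-1)\<^sup>2, (-2)\<^sup>3\<close>. The two are not isomorphic, since the Petersen graph has no triangle.
\<close>

section \<open>Trace and spectrum of real symmetric matrices\<close>

definition mat_trace :: "'a :: comm_monoid_add mat \<Rightarrow> 'a" where
  "mat_trace A = (\<Sum>i<dim_row A. A $$ (i, i))"

lemma mat_trace_mult_expand:
  assumes "A \<in> carrier_mat n m" "B \<in> carrier_mat m n"
  shows "mat_trace (A * B) = (\<Sum>i<n. \<Sum>j<m. A $$ (i, j) * B $$ (j, i))"
  using assms by (auto simp: mat_trace_def scalar_prod_def lessThan_atLeast0 intro!: sum.cong)

lemma mat_trace_mult_commute:
  fixes A :: "'a :: comm_semiring_0 mat"
  assumes "A \<in> carrier_mat n m" "B \<in> carrier_mat m n"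
  shows "mat_trace (A * B) = mat_trace (B * A)"
  unfolding mat_trace_mult_expand[OF assms] mat_trace_mult_expand[OF assms(2,1)]
  by (subst sum.swap) (simp add: mult.commute)

text \<open>Products of upper triangular matrices multiply the diagonals entrywise, so the trace of a power is
the power sum of the diagonal.\<close>

lemma upper_triangular_pow_entries:
  fixes B :: "'a :: comm_semiring_1 mat"
  assumes B: "B \<in> carrier_mat n n" "upper_triangular B"
  shows "i < n \<Longrightarrow> j < n \<Longrightarrow> j < i \<Longrightarrow> (B ^\<^sub>m k) $$ (i, j) = 0"
    and "i < n \<Longrightarrow> (B ^\<^sub>m k) $$ (i, i) = B $$ (i, i) ^ k"
proof (induction k arbitrary: i j)
  case 0
  { case 1 then show ?case using B by auto next case 2 then show ?case using B by auto }
next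
  case (Suc k)
  have entry: "(B ^\<^sub>m Suc k) $$ (i, j) = (\<Sum>l<n. (B ^\<^sub>m k) $$ (i, l) * B $$ (l, j))"
    if "i < n" "j < n" for i j
    using that B(1) by (simp add: scalar_prod_def lessThan_atLeast0)
  { case 1
    have "(B ^\<^sub>m k) $$ (i, l) * B $$ (l, j) = 0" if "l < n" for l
      using Suc.IH(1)[of i l] upper_triangularD[OF B(2), of j l] B(1) 1 that
      by (cases "l < i") auto
    then show ?case using entry 1 by simp
  next
    case 2
    have "(B ^\<^sub>m k) $$ (i, l) * B $$ (l, i) = 0" if "l < n" "l \<noteq> i" for l
      using Suc.IH(1)[of i l] upper_triangularD[OF B(2), of i l] B(1) 2 that
      by (cases "l < i") auto
    then have "(\<Sum>l<n. (B ^\<^sub>m k) $$ (i, l) * B $$ (l, i)) = (B ^\<^sub>m k) $$ (i, i) * B $$ (i, i)"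
      using 2 by (subst sum.remove[of _ i]) (auto intro!: sum.neutral)
    then show ?case using entry[OF 2 2] Suc.IH(2)[OF 2] by (simp add: mult.commute)
  }
qed

text \<open>For an eigenvector \<open>v\<close>, the quadratic form \<open>v\<^sup>* A v\<close> equals \<open>a\<close> times the squared norm of \<open>v\<close>; it is
its own conjugate because \<open>A\<close> is real and symmetric.\<close>

lemma real_symmetric_eigenvalue_real:
  fixes A :: "real mat"
  assumes A: "A \<in> carrier_mat n n" and sym: "\<And>i j. i < n \<Longrightarrow> j < n \<Longrightarrow> A $$ (i, j) = A $$ (j, i)"
    and ev: "eigenvalue (map_mat complex_of_real A) a"
  shows "a \<in> \<real>"
proof -
  obtain v where v: "v \<in> carrier_vec n" "v \<noteq> 0\<^sub>v n" "map_mat complex_of_real A *\<^sub>v v = a \<cdot>\<^sub>v v"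
    using ev A by (auto simp: eigenvalue_def eigenvector_def)
  have Av: "(\<Sum>j<n. of_real (A $$ (i, j)) * v $ j) = a * v $ i" if "i < n" for i
    using arg_cong[OF v(3), of "\<lambda>w. w $ i"] that A v(1)
    by (simp add: scalar_prod_def lessThan_atLeast0)
  define s where "s = (\<Sum>i<n. \<Sum>j<n. cnj (v $ i) * of_real (A $$ (i, j)) * v $ j)"
  define N where "N = (\<Sum>i<n. (cmod (v $ i))\<^sup>2)"
  have s: "s = a * of_real N"
  proof -
    have "s = (\<Sum>i<n. cnj (v $ i) * (\<Sum>j<n. of_real (A $$ (i, j)) * v $ j))"
      by (simp add: s_def sum_distrib_left mult.assoc)
    also have "\<dots> = (\<Sum>i<n. a * of_real ((cmod (v $ i))\<^sup>2))"
    proof (rule sum.cong)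
      fix i assume "i \<in> {..<n}"
      then show "cnj (v $ i) * (\<Sum>j<n. of_real (A $$ (i, j)) * v $ j) = a * of_real ((cmod (v $ i))\<^sup>2)"
        using Av[of i] complex_norm_square[of "v $ i"] by simp
    qed simp
    finally show ?thesis by (simp add: N_def sum_distrib_left)
  qed
  have "cnj s = (\<Sum>i<n. \<Sum>j<n. v $ i * of_real (A $$ (i, j)) * cnj (v $ j))"
    by (simp add: s_def)
  also have "\<dots> = s"
    unfolding s_def by (subst sum.swap) (auto intro!: sum.cong simp: sym mult_ac)
  finally have "cnj s = s" .
  moreover have "N \<noteq> 0"
  proof
    assume "N = 0"
    then have "\<forall>i<n. v $ i = 0" by (auto simp: N_def sum_nonneg_eq_0_iff)
    then have "v = 0\<^sub>v n" using v(1) by (intro eq_vecI) auto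
    then show False using v(2) by simp
  qed
  ultimately have "cnj a = a" using s by simp
  then show ?thesis by (simp add: complex_is_Real_iff complex_eq_iff)
qed

text \<open>Over the complex numbers the characteristic polynomial splits, and its roots are real by the
previous lemma. Hence it splits over the reals, and the real Schur decomposition makes \<open>A\<close> similar
to an upper triangular matrix with the eigenvalues on the diagonal.\<close>

theorem real_symmetric_spectrum:
  fixes A :: "real mat"
  assumes A: "A \<in> carrier_mat n n" and sym: "\<And>i j. i < n \<Longrightarrow> j < n \<Longrightarrow> A $$ (i, j) = A $$ (j, i)"
  obtains es where "length es = n" "char_poly A = (\<Prod>e\<leftarrow>es. [:- e, 1:])"
    "\<And>k. mat_trace (A ^\<^sub>m k) = (\<Sum>e\<leftarrow>es. e ^ k)"
proof -
  let ?C = "map_mat complex_of_real A"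
  have C: "?C \<in> carrier_mat n n" using A by simp
  obtain as where as: "char_poly ?C = (\<Prod>a\<leftarrow>as. [:- a, 1:])" "length as = n"
    using char_poly_factorized[OF C] by blast
  have "a \<in> \<real>" if "a \<in> set as" for a
  proof (rule real_symmetric_eigenvalue_real[OF A sym])
    have "poly (char_poly ?C) a = 0" using that by (auto simp: as(1) poly_prod_list prod_list_zero_iff)
    then show "eigenvalue ?C a" using eigenvalue_root_char_poly[OF C] by simp
  qed
  then have as_re: "as = map of_real (map Re as)"
    by (auto simp: map_idI[symmetric] intro!: nth_equalityI)
  define es where "es = map Re as"
  interpret hom: map_poly_inj_comm_ring_hom complex_of_real ..
  have "char_poly ?C = map_poly complex_of_real (char_poly A)"
    by (rule of_real_hom.char_poly_hom[OF A])
  then have "map_poly complex_of_real (char_poly A) = (\<Prod>a\<leftarrow>as. [:- a, 1:])"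
    using as(1) by simp
  also have "\<dots> = map_poly complex_of_real (\<Prod>e\<leftarrow>es. [:- e, 1:])"
    by (subst as_re) (simp add: es_def hom.hom_prod_list o_def)
  finally have cp: "char_poly A = (\<Prod>e\<leftarrow>es. [:- e, 1:])"
    by (simp only: hom.eq_iff)
  obtain B P Q where BPQ: "schur_decomposition A es = (B, P, Q)" by (metis prod_cases3)
  from schur_decomposition[OF A cp BPQ] have
    wit: "similar_mat_wit A B P Q" and ut: "upper_triangular B" and diag: "diag_mat B = es" by auto
  from similar_mat_witD2[OF A wit] have carr: "B \<in> carrier_mat n n" "P \<in> carrier_mat n n"
    "Q \<in> carrier_mat n n" and QP: "Q * P = 1\<^sub>m n" by auto
  have "mat_trace (A ^\<^sub>m k) = (\<Sum>e\<leftarrow>es. e ^ k)" for k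
  proof -
    have Bk: "B ^\<^sub>m k \<in> carrier_mat n n" using carr by simp
    have "mat_trace (A ^\<^sub>m k) = mat_trace (P * B ^\<^sub>m k * Q)"
      using similar_mat_wit_pow_id[OF wit] by simp
    also have "\<dots> = mat_trace (Q * (P * B ^\<^sub>m k))"
      by (rule mat_trace_mult_commute) (use carr Bk in auto)
    also have "Q * (P * B ^\<^sub>m k) = B ^\<^sub>m k"
      by (metis QP assoc_mult_mat[OF carr(3,2) Bk] left_mult_one_mat[OF Bk])
    also have "mat_trace (B ^\<^sub>m k) = (\<Sum>i<n. B $$ (i, i) ^ k)"
      using carr(1) upper_triangular_pow_entries(2)[OF carr(1) ut] by (simp add: mat_trace_def)
    also have "\<dots> = (\<Sum>e\<leftarrow>es. e ^ k)"
      using carr(1) by (simp add: diag[symmetric] diag_mat_def o_def interv_sum_list_conv_sum_set_nat lessThan_atLeast0)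
    finally show ?thesis .
  qed
  moreover have "length es = n" using as(2) by (simp add: es_def)
  ultimately show ?thesis using that cp by blast
qed

lemma pow_mat_Suc_left:
  assumes "A \<in> carrier_mat n n"
  shows "A ^\<^sub>m Suc k = A * A ^\<^sub>m k"
proof (induction k)
  case 0 then show ?case using assms by simp
next
  case (Suc k)
  have "A ^\<^sub>m Suc (Suc k) = (A * A ^\<^sub>m k) * A" using Suc by simp
  also have "\<dots> = A * A ^\<^sub>m Suc k" using assms by (simp add: assoc_mult_mat[of _ n n _ n _ n])
  finally show ?case .
qed

lemma pow_mat_add:
  assumes "A \<in> carrier_mat n n"
  shows "A ^\<^sub>m (k + l) = A ^\<^sub>m k * A ^\<^sub>m l"
proof (induction l)
  case 0 then show ?case using assms by simp
next
  case (Suc l)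
  then show ?case using assms by (simp add: assoc_mult_mat[of _ n n _ n _ n])
qed

lemma smult_pow_mat:
  fixes A :: "'a :: comm_semiring_1 mat"
  assumes "A \<in> carrier_mat n n"
  shows "(c \<cdot>\<^sub>m A) ^\<^sub>m k = c ^ k \<cdot>\<^sub>m A ^\<^sub>m k"
proof (induction k)
  case 0 then show ?case using assms by (auto intro: eq_matI)
next
  case (Suc k)
  have "(c \<cdot>\<^sub>m A) ^\<^sub>m Suc k = (c ^ k \<cdot>\<^sub>m A ^\<^sub>m k) * (c \<cdot>\<^sub>m A)" using Suc by simp
  also have "\<dots> = (c ^ k * c) \<cdot>\<^sub>m (A ^\<^sub>m k * A)"
    using assms by (intro eq_matI) (auto simp: scalar_prod_def sum_distrib_left mult_ac)
  finally show ?case by (simp add: mult.commute)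
qed

lemma symmetric_pow_mat:
  fixes A :: "'a :: comm_semiring_1 mat"
  assumes A: "A \<in> carrier_mat n n" and sym: "\<And>i j. i < n \<Longrightarrow> j < n \<Longrightarrow> A $$ (i, j) = A $$ (j, i)"
  shows "i < n \<Longrightarrow> j < n \<Longrightarrow> (A ^\<^sub>m k) $$ (i, j) = (A ^\<^sub>m k) $$ (j, i)"
proof (induction k arbitrary: i j)
  case 0 then show ?case using A by auto
next
  case (Suc k)
  have "(A ^\<^sub>m Suc k) $$ (i, j) = (\<Sum>l<n. (A ^\<^sub>m k) $$ (i, l) * A $$ (l, j))"
    using Suc.prems A by (simp add: scalar_prod_def lessThan_atLeast0)
  also have "\<dots> = (\<Sum>l<n. A $$ (j, l) * (A ^\<^sub>m k) $$ (l, i))"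
    using Suc by (intro sum.cong) (auto simp: sym mult.commute)
  also have "\<dots> = (A ^\<^sub>m Suc k) $$ (j, i)"
    unfolding pow_mat_Suc_left[OF A] using Suc.prems A by (simp add: scalar_prod_def lessThan_atLeast0)
  finally show ?case .
qed

text \<open>\<open>A\<^sup>2\<^sup>k\<close> is the product of \<open>A\<^sup>k\<close> with its own transpose, so only powers up to half the
length of the closed walks have to be computed.\<close>

lemma mat_trace_even_pow:
  fixes A :: "'a :: comm_semiring_1 mat"
  assumes A: "A \<in> carrier_mat n n" and sym: "\<And>i j. i < n \<Longrightarrow> j < n \<Longrightarrow> A $$ (i, j) = A $$ (j, i)"
  shows "mat_trace (A ^\<^sub>m (2 * k)) = (\<Sum>i<n. \<Sum>j<n. ((A ^\<^sub>m k) $$ (i, j))\<^sup>2)"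
  unfolding mult_2 pow_mat_add[OF A]
  using symmetric_pow_mat[OF A sym]
  by (subst mat_trace_mult_expand[of _ n n]) (use A in \<open>auto intro!: sum.cong simp: power2_eq_square\<close>)

lemma mat_trace_smult: "mat_trace (c \<cdot>\<^sub>m A) = c * mat_trace (A :: 'a :: comm_semiring_0 mat)"
  if "A \<in> carrier_mat n n"
  using that by (simp add: mat_trace_def sum_distrib_left)

lemma order_prod_list_linear:
  "Polynomial.order k (\<Prod>e\<leftarrow>es. [:- e, 1:]) = count_list es (k :: 'a :: idom)"
proof (induction es)
  case (Cons e es)
  have "[:- e, 1:] * (\<Prod>e\<leftarrow>es. [:- e, 1:]) \<noteq> (0 :: 'a poly)"
    unfolding mult_eq_0_iff prod_list_zero_iff by auto
  moreover have "Polynomial.order k [:- e, 1:] = (if e = k then 1 else 0)"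
    using order_power_n_n[of k 1] by (auto intro: order_0I)
  ultimately show ?case
    using Cons.IH order_mult[of "[:- e, 1:]" "\<Prod>e\<leftarrow>es. [:- e, 1:]" k]
    by (simp del: mult_pCons_left)
qed simp

lemma sum_count_list:
  fixes f :: "'a \<Rightarrow> real"
  assumes "finite S" "set xs \<subseteq> S"
  shows "(\<Sum>x\<in>S. real (count_list xs x) * f x) = (\<Sum>x\<leftarrow>xs. f x)"
  using assms(2)
proof (induction xs)
  case (Cons a xs)
  have "(\<Sum>x\<in>S. real (count_list (a # xs) x) * f x)
      = (\<Sum>x\<in>S. (if a = x then f x else 0) + real (count_list xs x) * f x)"
    by (rule sum.cong) (auto simp: distrib_right)
  then show ?case using Cons assms(1) by (simp add: sum.distrib)
qed simp

lemma matrix_energy_eq_sum_list: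
  assumes A: "A \<in> carrier_mat n n" and cp: "char_poly A = (\<Prod>e\<leftarrow>es. [:- e, 1:])"
  shows "matrix_energy A = (\<Sum>e\<leftarrow>es. \<bar>e\<bar>)"
proof -
  have "{k. eigenvalue A k} = set es"
    by (auto simp: eigenvalue_root_char_poly[OF A] cp poly_prod_list prod_list_zero_iff)
  then show ?thesis
    by (simp add: matrix_energy_def cp order_prod_list_linear sum_count_list)
qed

section \<open>An even sextic majorant of the absolute value\<close>

text \<open>The coefficients are determined by requiring that \<open>majorant a b x - \<bar>x\<bar>\<close> be divisible by
\<open>(\<bar>x\<bar> - a)\<^sup>2 (\<bar>x\<bar> - b)\<^sup>2\<close> with a quadratic cofactor and that the only odd power of \<open>\<bar>x\<bar>\<close> left be
\<open>- \<bar>x\<bar>\<close> itself. With \<open>a, b = 1, 2\<close> this is \<open>(x\<^sup>6 - 12 x\<^sup>4 + 75 x\<^sup>2 + 44) / 108\<close>, and with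
\<open>a, b = 1, 3\<close> it is \<open>(x\<^sup>6 - 23 x\<^sup>4 + 235 x\<^sup>2 + 171) / 384\<close>.\<close>

definition majorant :: "real \<Rightarrow> real \<Rightarrow> real \<Rightarrow> real" where
  "majorant a b x = (let s = a + b; p = a * b in
     (x ^ 6 + (3 * p - 2 * s ^ 2) * x ^ 4 + (s ^ 4 - s ^ 2 * p + 3 * p ^ 2) * x ^ 2
       + (s ^ 2 + p) * p ^ 2) / (2 * s ^ 3 * p))"

lemma majorant_minus_abs:
  assumes "a > 0" "b > 0"
  shows "majorant a b x - \<bar>x\<bar> = (\<bar>x\<bar> - a) ^ 2 * (\<bar>x\<bar> - b) ^ 2
    * (x ^ 2 + 2 * (a + b) * \<bar>x\<bar> + (a + b) ^ 2 + a * b) / (2 * (a + b) ^ 3 * (a * b))"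
proof -
  define y where "y = \<bar>x\<bar>"
  define s where "s = a + b"
  define p where "p = a * b"
  have y: "x ^ 2 = y ^ 2" "x ^ 4 = y ^ 4" "x ^ 6 = y ^ 6"
    by (simp_all add: y_def power_even_abs)
  have "2 * s ^ 3 * p \<noteq> 0" using assms by (simp add: s_def p_def)
  then have "majorant a b x - y = (y ^ 6 + (3 * p - 2 * s ^ 2) * y ^ 4
      + (s ^ 4 - s ^ 2 * p + 3 * p ^ 2) * y ^ 2 + (s ^ 2 + p) * p ^ 2 - y * (2 * s ^ 3 * p)) / (2 * s ^ 3 * p)"
    by (simp add: majorant_def y flip: s_def p_def) (simp add: diff_divide_distrib)
  also have "y ^ 6 + (3 * p - 2 * s ^ 2) * y ^ 4 + (s ^ 4 - s ^ 2 * p + 3 * p ^ 2) * y ^ 2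
      + (s ^ 2 + p) * p ^ 2 - y * (2 * s ^ 3 * p) = (y ^ 2 - s * y + p) ^ 2 * (y ^ 2 + 2 * s * y + s ^ 2 + p)"
    by (simp add: eval_nat_numeral algebra_simps)
  also have "y ^ 2 - s * y + p = (y - a) * (y - b)"
    by (simp add: s_def p_def algebra_simps power2_eq_square)
  finally show ?thesis
    by (simp add: s_def p_def y power_mult_distrib flip: y_def)
qed

lemma abs_le_majorant:
  assumes "a > 0" "b > 0"
  shows "\<bar>x\<bar> \<le> majorant a b x"
proof -
  have "0 \<le> majorant a b x - \<bar>x\<bar>"
    unfolding majorant_minus_abs[OF assms] using assms by (intro divide_nonneg_pos mult_nonneg_nonneg add_nonneg_nonneg) auto
  then show ?thesis by simp
qed

lemma sum_list_majorant:
  "(\<Sum>x\<leftarrow>xs. majorant a b x) = (let s = a + b; p = a * b in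
     ((\<Sum>x\<leftarrow>xs. x ^ 6) + (3 * p - 2 * s ^ 2) * (\<Sum>x\<leftarrow>xs. x ^ 4)
       + (s ^ 4 - s ^ 2 * p + 3 * p ^ 2) * (\<Sum>x\<leftarrow>xs. x ^ 2)
       + (s ^ 2 + p) * p ^ 2 * length xs) / (2 * s ^ 3 * p))"
  by (induction xs) (simp_all add: majorant_def Let_def add_divide_distrib[symmetric] algebra_simps)

lemma sum_list_abs_le_majorant:
  assumes "a > 0" "b > 0"
  shows "(\<Sum>x\<leftarrow>xs. \<bar>x\<bar>) \<le> (\<Sum>x\<leftarrow>xs. majorant a b x)"
  by (intro sum_list_mono abs_le_majorant assms)

lemma sum_list_remove1:
  fixes f :: "'a \<Rightarrow> real"
  assumes "z \<in> set xs"
  shows "(\<Sum>x\<leftarrow>remove1 z xs. f x) = (\<Sum>x\<leftarrow>xs. f x) - f z"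
  using sum_list_map_remove1[OF assms, of f] by simp

text \<open>At \<open>3\<close> the polynomial \<open>majorant 1 2\<close> exceeds the absolute value by more than one. That loss is
avoided by leaving one entry \<open>3\<close> out of the estimate.\<close>

lemma sum_abs_le_16_except_3:
  fixes xs :: "real list"
  assumes "length xs = 10" "3 \<in> set xs" "(\<Sum>x\<leftarrow>xs. x ^ 2) = 30"
    and "(\<Sum>x\<leftarrow>xs. x ^ 6) - 12 * (\<Sum>x\<leftarrow>xs. x ^ 4) \<le> -810"
  shows "(\<Sum>x\<leftarrow>xs. \<bar>x\<bar>) \<le> 16"
  using sum_list_abs_le_majorant[of 1 2 "remove1 3 xs"] assms
  by (simp add: sum_list_majorant sum_list_remove1 length_remove1 field_simps)

text \<open>The contact points \<open>\<plusminus>1\<close> and \<open>\<plusminus>3\<close> suit lists in which \<open>3\<close> or \<open>-3\<close> occurs repeatedly; no entry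
has to be singled out, as the majorant is exact at \<open>3\<close>.\<close>

lemma sum_abs_le_16:
  fixes xs :: "real list"
  assumes "length xs = 10" "(\<Sum>x\<leftarrow>xs. x ^ 2) = 30"
    and "(\<Sum>x\<leftarrow>xs. x ^ 6) - 23 * (\<Sum>x\<leftarrow>xs. x ^ 4) \<le> -2616"
  shows "(\<Sum>x\<leftarrow>xs. \<bar>x\<bar>) \<le> 16"
  using sum_list_abs_le_majorant[of 1 3 xs] assms
  by (simp add: sum_list_majorant field_simps)

text \<open>The prescribed power sums make the nonnegative polynomial \<open>(x\<^sup>2 - 1)\<^sup>2 (x\<^sup>2 - 4)\<^sup>2\<close> sum to \<open>1600\<close>, which
the entry \<open>3\<close> contributes alone. So every other entry is \<open>\<plusminus>1\<close> or \<open>\<plusminus>2\<close>, where the majorant is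
exact.\<close>

lemma sum_abs_eq_16:
  fixes xs :: "real list"
  assumes len: "length xs = 10" and "3 \<in> set xs" and p2: "(\<Sum>x\<leftarrow>xs. x ^ 2) = 30"
    and p4: "(\<Sum>x\<leftarrow>xs. x ^ 4) = 150" and p6: "(\<Sum>x\<leftarrow>xs. x ^ 6) = 990" and p8: "(\<Sum>x\<leftarrow>xs. x ^ 8) = 7590"
  shows "(\<Sum>x\<leftarrow>xs. \<bar>x\<bar>) = 16"
proof -
  define ys where "ys = remove1 3 xs"
  have rem: "(\<Sum>y\<leftarrow>ys. f y) = (\<Sum>x\<leftarrow>xs. f x) - f 3" for f :: "real \<Rightarrow> real"
    unfolding ys_def by (rule sum_list_remove1) fact
  have "(\<Sum>y\<leftarrow>zs. (y ^ 2 - 1) ^ 2 * (y ^ 2 - 4) ^ 2) = (\<Sum>y\<leftarrow>zs. y ^ 8) - 10 * (\<Sum>y\<leftarrow>zs. y ^ 6)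
      + 33 * (\<Sum>y\<leftarrow>zs. y ^ 4) - 40 * (\<Sum>y\<leftarrow>zs. y ^ 2) + 16 * length zs" for zs :: "real list"
  proof (induction zs)
    case (Cons z zs)
    have "(z ^ 2 - 1) ^ 2 * (z ^ 2 - 4) ^ 2 = z ^ 8 - 10 * z ^ 6 + 33 * z ^ 4 - 40 * z ^ 2 + 16"
      by (simp add: eval_nat_numeral algebra_simps)
    then show ?case using Cons by (simp add: algebra_simps)
  qed simp
  then have "(\<Sum>y\<leftarrow>ys. (y ^ 2 - 1) ^ 2 * (y ^ 2 - 4) ^ 2) = 0"
    using p2 p4 p6 p8 len \<open>3 \<in> set xs\<close> by (simp add: rem ys_def length_remove1 sum_list_remove1)
  then have zero: "(y ^ 2 - 1) ^ 2 * (y ^ 2 - 4) ^ 2 = 0" if "y \<in> set ys" for y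
    using sum_list_nonneg_eq_0_iff[of "map (\<lambda>y. (y ^ 2 - 1) ^ 2 * (y ^ 2 - 4) ^ 2) ys"] that
    by fastforce
  have "\<bar>y\<bar> = majorant 1 2 y" if "y \<in> set ys" for y
  proof -
    have "y ^ 2 = 1 ^ 2 \<or> y ^ 2 = 2 ^ 2" using zero[OF that] by auto
    then have "\<bar>y\<bar> = 1 \<or> \<bar>y\<bar> = 2" unfolding power2_eq_iff by linarith
    then have "majorant 1 2 y - \<bar>y\<bar> = 0" by (subst majorant_minus_abs) auto
    then show ?thesis by simp
  qed
  then have "(\<Sum>y\<leftarrow>ys. \<bar>y\<bar>) = (\<Sum>y\<leftarrow>ys. majorant 1 2 y)"
    by (metis map_eq_conv)
  also have "\<dots> = 13"
    unfolding sum_list_majorant using p2 p4 p6 len \<open>3 \<in> set xs\<close>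
    by (simp add: sum_list_remove1 length_remove1 ys_def)
  finally show ?thesis using rem[of abs] by simp
qed

section \<open>Adjacency lists of graphs\<close>

definition neighbours :: "'a pair_pre_digraph \<Rightarrow> 'a \<Rightarrow> 'a set" where
  "neighbours G v = {w. (v, w) \<in> parcs G}"

lemma degree_of_eq_card_neighbours: "degree_of G v = card (neighbours G v)"
proof -
  have "out_arcs (with_proj G) v = Pair v ` neighbours G v"
    by (auto simp: out_arcs_def neighbours_def)
  then show ?thesis
    by (simp add: degree_of_def out_degree_def card_image inj_on_def)
qed

lemma pair_graph_sym: "pair_graph G \<Longrightarrow> (u, v) \<in> parcs G \<Longrightarrow> (v, u) \<in> parcs G"
  using pair_sym_digraph.pair_sym_arcs[of G] pair_graph.axioms(2) pair_pseudo_graph.axioms(2)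
  by (metis symmetric_def with_proj_simps(3) symD)

text \<open>Vertices are referred to by their positions in \<open>vs\<close>, which makes graphs on an arbitrary vertex
type accessible to evaluation.\<close>

definition is_adj_list :: "'a pair_pre_digraph \<Rightarrow> 'a list \<Rightarrow> nat list list \<Rightarrow> bool" where
  "is_adj_list G vs g \<longleftrightarrow> is_vertex_enum G vs \<and> length g = length vs \<and>
     (\<forall>i<length vs. distinct (g ! i) \<and> set (g ! i) = {j. j < length vs \<and> (vs ! i, vs ! j) \<in> parcs G})"

lemma pair_graph_loopfree: "pair_graph G \<Longrightarrow> (u, u) \<notin> parcs G"
  using pair_loopfree_digraph.pair_no_loops[of G "(u, u)"]
  by (auto simp: pair_graph_def pair_digraph_def)

lemma pair_graph_neighbours_subset: "pair_graph G \<Longrightarrow> neighbours G u \<subseteq> pverts G"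
  using pair_wf_digraph.in_arcsD2[of G]
  by (auto simp: neighbours_def pair_graph_def pair_digraph_def pair_fin_digraph_def)

section \<open>Energy of a regular graph and its closed walks\<close>

definition adj_rows :: "nat list list \<Rightarrow> int list list" where
  "adj_rows g = map (\<lambda>r. map (\<lambda>j. if j \<in> set r then 1 else 0) [0..<length g]) g"

definition extend_walks :: "nat list list \<Rightarrow> int list list \<Rightarrow> int list list" where
  "extend_walks g W = map (\<lambda>r. foldr (\<lambda>a. map2 (+) (W ! a)) r (replicate (length g) 0)) g"

definition square_sum :: "int list list \<Rightarrow> int" where
  "square_sum W = sum_list (map (\<lambda>r. sum_list (map (\<lambda>x. x * x) r)) W)"

text \<open>Row \<open>i\<close>, column \<open>j\<close> of \<open>walks g k\<close> counts the walks of length \<open>k + 1\<close> from \<open>i\<close> to \<open>j\<close>: the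
matrix power with exponent \<open>k + 1\<close>, computed by adding up the rows of the neighbours.\<close>

fun walks :: "nat list list \<Rightarrow> nat \<Rightarrow> int list list" where
  "walks g 0 = adj_rows g"
| "walks g (Suc k) = extend_walks g (walks g k)"

definition adjacency_mat :: "nat list list \<Rightarrow> real mat" where
  "adjacency_mat g = mat (length g) (length g) (\<lambda>(i, j). if j \<in> set (g ! i) then 1 else 0)"

lemma adjacency_mat_carrier: "adjacency_mat g \<in> carrier_mat (length g) (length g)"
  by (simp add: adjacency_mat_def)

definition well_formed :: "nat list list \<Rightarrow> bool" where
  "well_formed g \<longleftrightarrow> (\<forall>r\<in>set g. distinct r \<and> set r \<subseteq> {..<length g})"

lemma foldr_rows:
  assumes "\<forall>a\<in>set r. length (W ! a) = n"
  shows "length (foldr (\<lambda>a. map2 (+) (W ! a)) r (replicate n 0)) = n"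
    and "j < n \<Longrightarrow> foldr (\<lambda>a. map2 (+) (W ! a)) r (replicate n 0) ! j = (\<Sum>a\<leftarrow>r. W ! a ! j :: int)"
proof -
  have "length (foldr (\<lambda>a. map2 (+) (W ! a)) r (replicate n 0)) = n \<and>
      (j < n \<longrightarrow> foldr (\<lambda>a. map2 (+) (W ! a)) r (replicate n 0) ! j = (\<Sum>a\<leftarrow>r. W ! a ! j :: int))"
    using assms by (induction r) auto
  then show "length (foldr (\<lambda>a. map2 (+) (W ! a)) r (replicate n 0)) = n"
    and "j < n \<Longrightarrow> foldr (\<lambda>a. map2 (+) (W ! a)) r (replicate n 0) ! j = (\<Sum>a\<leftarrow>r. W ! a ! j :: int)"
    by auto
qed

lemma walks_eq_adjacency_mat_pow:
  assumes wf: "well_formed g"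
  shows "length (walks g k) = length g \<and> (\<forall>i<length g. length (walks g k ! i) = length g) \<and>
    (\<forall>i<length g. \<forall>j<length g. (adjacency_mat g ^\<^sub>m Suc k) $$ (i, j) = real_of_int (walks g k ! i ! j))"
proof (induction k)
  case 0
  then show ?case using adjacency_mat_carrier[of g] by (auto simp: adj_rows_def adjacency_mat_def)
next
  case (Suc k)
  let ?n = "length g"
  have row: "\<forall>a\<in>set (g ! i). length (walks g k ! a) = ?n" "set (g ! i) \<subseteq> {..<?n}" "distinct (g ! i)"
    if "i < ?n" for i
  proof -
    have "distinct (g ! i)" "set (g ! i) \<subseteq> {..<?n}"
      using wf nth_mem[OF that] by (auto simp: well_formed_def)
    then show "\<forall>a\<in>set (g ! i). length (walks g k ! a) = ?n" "set (g ! i) \<subseteq> {..<?n}" "distinct (g ! i)"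
      using Suc by auto
  qed
  have "(adjacency_mat g ^\<^sub>m Suc (Suc k)) $$ (i, j) = real_of_int (walks g (Suc k) ! i ! j)"
    if ij: "i < ?n" "j < ?n" for i j
  proof -
    have "(adjacency_mat g ^\<^sub>m Suc (Suc k)) $$ (i, j)
        = (\<Sum>l<?n. adjacency_mat g $$ (i, l) * (adjacency_mat g ^\<^sub>m Suc k) $$ (l, j))"
      unfolding pow_mat_Suc_left[OF adjacency_mat_carrier, of g "Suc k"]
      using ij adjacency_mat_carrier[of g]
      by (simp add: scalar_prod_def lessThan_atLeast0 del: pow_mat.simps)
    also have "\<dots> = (\<Sum>l<?n. if l \<in> set (g ! i) then real_of_int (walks g k ! l ! j) else 0)"
      using ij Suc by (intro sum.cong) (auto simp: adjacency_mat_def)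
    also have "\<dots> = (\<Sum>l\<in>set (g ! i). real_of_int (walks g k ! l ! j))"
      using row(2)[OF ij(1)] by (simp add: sum.If_cases Int_absorb1)
    also have "\<dots> = real_of_int (\<Sum>l\<leftarrow>g ! i. walks g k ! l ! j)"
      using row(3)[OF ij(1)] by (simp add: sum_list_distinct_conv_sum_set)
    also have "\<dots> = real_of_int (walks g (Suc k) ! i ! j)"
      using ij foldr_rows(2)[OF row(1)[OF ij(1)] ij(2)] by (simp add: extend_walks_def)
    finally show ?thesis .
  qed
  then show ?case using row(1) foldr_rows(1) by (auto simp: extend_walks_def)
qed

lemma square_sum_eq:
  assumes "length W = n" "\<forall>i<n. length (W ! i) = n"
  shows "square_sum W = (\<Sum>i<n. \<Sum>j<n. (W ! i ! j)\<^sup>2)"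
  using assms by (simp add: square_sum_def sum_list_sum_nth lessThan_atLeast0 power2_eq_square)

lemma trace_adjacency_mat_even_pow:
  assumes wf: "well_formed g" and sym: "\<And>i j. i < length g \<Longrightarrow> j < length g \<Longrightarrow> j \<in> set (g ! i) \<longleftrightarrow> i \<in> set (g ! j)"
  shows "mat_trace (adjacency_mat g ^\<^sub>m (2 * Suc k)) = square_sum (walks g k)"
proof -
  note W = walks_eq_adjacency_mat_pow[OF wf, of k]
  have "mat_trace (adjacency_mat g ^\<^sub>m (2 * Suc k))
      = (\<Sum>i<length g. \<Sum>j<length g. ((adjacency_mat g ^\<^sub>m Suc k) $$ (i, j))\<^sup>2)"
    using sym by (intro mat_trace_even_pow[OF adjacency_mat_carrier]) (simp add: adjacency_mat_def)
  also have "\<dots> = (\<Sum>i<length g. \<Sum>j<length g. (real_of_int (walks g k ! i ! j))\<^sup>2)"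
    using W by (intro sum.cong) auto
  also have "\<dots> = square_sum (walks g k)"
    using W by (subst square_sum_eq) auto
  finally show ?thesis .
qed

definition eso_weight :: "nat \<Rightarrow> real" where
  "eso_weight d = (real d + real d) * sqrt ((real d)\<^sup>2 + (real d)\<^sup>2)"

lemma eso_weight_pos: "0 < d \<Longrightarrow> 0 < eso_weight d"
  by (simp add: eso_weight_def)

lemma is_adj_list_wf:
  assumes "is_adj_list G vs g" "pair_graph G"
  shows "well_formed g"
    and "i < length g \<Longrightarrow> j < length g \<Longrightarrow> j \<in> set (g ! i) \<longleftrightarrow> i \<in> set (g ! j)"
proof -
  show "well_formed g"
    unfolding well_formed_def
  proof
    fix r assume "r \<in> set g"
    then obtain i where "i < length vs" "r = g ! i"
      using assms(1) by (auto simp: is_adj_list_def in_set_conv_nth)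
    then show "distinct r \<and> set r \<subseteq> {..<length g}"
      using assms(1) by (auto simp: is_adj_list_def)
  qed
  show "i < length g \<Longrightarrow> j < length g \<Longrightarrow> j \<in> set (g ! i) \<longleftrightarrow> i \<in> set (g ! j)"
    using assms(1) pair_graph_sym[OF assms(2)] by (auto simp: is_adj_list_def)
qed

lemma is_adj_list_length_row:
  assumes code: "is_adj_list G vs g" and G: "pair_graph G" and i: "i < length g"
  shows "length (g ! i) = degree_of G (vs ! i)"
proof -
  have g: "distinct (g ! i)" "set (g ! i) = {j. j < length vs \<and> (vs ! i, vs ! j) \<in> parcs G}"
    and vs: "distinct vs" "set vs = pverts G" and i': "i < length vs"
    using code i by (auto simp: is_adj_list_def is_vertex_enum_def)
  have "neighbours G (vs ! i) \<subseteq> set vs"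
    using pair_wf_digraph.in_arcsD2[of G] G vs
    by (auto simp: neighbours_def pair_graph_def pair_digraph_def pair_fin_digraph_def)
  then have "neighbours G (vs ! i) = (!) vs ` set (g ! i)"
    unfolding g(2) neighbours_def by (fastforce simp: in_set_conv_nth)
  moreover have "inj_on ((!) vs) (set (g ! i))"
    using vs(1) g(2) by (auto simp: inj_on_def nth_eq_iff_index_eq)
  ultimately show ?thesis
    using distinct_card[OF g(1)] by (simp add: degree_of_eq_card_neighbours card_image)
qed

lemma eso_matrix_regular:
  assumes code: "is_adj_list G vs g" and reg: "\<forall>v\<in>pverts G. degree_of G v = d"
  shows "eso_matrix G vs = eso_weight d \<cdot>\<^sub>m adjacency_mat g"
proof (rule eq_matI)
  have vs: "vs ! i \<in> pverts G" if "i < length vs" for i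
    using code that by (auto simp: is_adj_list_def is_vertex_enum_def)
  fix i j
  assume ij: "i < dim_row (eso_weight d \<cdot>\<^sub>m adjacency_mat g)"
    "j < dim_col (eso_weight d \<cdot>\<^sub>m adjacency_mat g)"
  then show "eso_matrix G vs $$ (i, j)
      = (eso_weight d \<cdot>\<^sub>m adjacency_mat g) $$ (i, j)"
    using code reg vs by (auto simp: is_adj_list_def eso_matrix_def adjacency_mat_def eso_weight_def Let_def)
qed (use code in \<open>auto simp: is_adj_list_def eso_matrix_def adjacency_mat_def\<close>)

lemma square_sum_adj_rows:
  assumes wf: "well_formed g" and reg: "\<forall>r\<in>set g. length r = d"
  shows "square_sum (adj_rows g) = int (length g * d)"
proof -
  have "(\<Sum>x\<leftarrow>map (\<lambda>j. if j \<in> set r then 1 else 0 :: int) [0..<length g]. x * x) = int d"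
    if r: "r \<in> set g" for r
  proof -
    have "(\<Sum>x\<leftarrow>map (\<lambda>j. if j \<in> set r then 1 else 0 :: int) [0..<length g]. x * x)
        = (\<Sum>j<length g. if j \<in> set r then 1 else 0)"
      by (simp add: o_def interv_sum_list_conv_sum_set_nat lessThan_atLeast0 if_distrib[of "\<lambda>x. x * x"] cong: if_cong)
    also have "\<dots> = int (card (set r))"
      using wf r by (simp add: sum.If_cases well_formed_def Int_absorb1)
    finally show ?thesis using wf r reg by (simp add: distinct_card well_formed_def)
  qed
  then have "square_sum (adj_rows g) = (\<Sum>r\<leftarrow>g. int d)"
    unfolding square_sum_def adj_rows_def by (simp add: o_def cong: map_cong)
  then show ?thesis by (simp add: sum_list_triv)
qed

text \<open>The list \<open>mus\<close> is the spectrum of the adjacency matrix. The all-ones vector makes the degree one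
of its entries, and its even power sums are numbers of closed walks.\<close>

theorem regular_graph_energy:
  assumes G: "G \<in> regular_graphs d n" and d: "d > 0" and n: "n > 0" and code: "is_adj_list G vs g"
  obtains mus :: "real list" where
    "length mus = n" "real d \<in> set mus" "(\<Sum>x\<leftarrow>mus. x\<^sup>2) = real (n * d)"
    "\<And>k. (\<Sum>x\<leftarrow>mus. x ^ (2 * Suc k)) = real_of_int (square_sum (walks g k))"
    "eso_energy G = eso_weight d * (\<Sum>x\<leftarrow>mus. \<bar>x\<bar>)"
proof -
  have pg: "pair_graph G" and cardG: "card (pverts G) = n" and reg: "\<forall>v\<in>pverts G. degree_of G v = d"
    using G by (auto simp: regular_graphs_def)
  have enum: "is_vertex_enum G vs" and len: "length g = length vs" using code by (auto simp: is_adj_list_def)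
  have lenn: "length g = n" using enum len cardG by (metis is_vertex_enum_def distinct_card)
  have rows: "length (g ! i) = d" if "i < n" for i
    using is_adj_list_length_row[OF code pg] that lenn enum len reg by (auto simp: is_vertex_enum_def)
  have rows': "\<forall>r\<in>set g. length r = d" using rows lenn by (auto simp: in_set_conv_nth)
  note wf = is_adj_list_wf(1)[OF code pg]
  note symm = is_adj_list_wf(2)[OF code pg]
  define c where "c = eso_weight d"
  have c: "c > 0" using eso_weight_pos[OF d] by (simp add: c_def)
  let ?A = "adjacency_mat g" and ?M = "c \<cdot>\<^sub>m adjacency_mat g"
  have A: "?A \<in> carrier_mat n n" using adjacency_mat_carrier[of g] lenn by simp
  then have M: "?M \<in> carrier_mat n n" by simp
  have Msym: "?M $$ (i, j) = ?M $$ (j, i)" if "i < n" "j < n" for i j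
    using that symm lenn by (simp add: adjacency_mat_def)
  obtain es where es: "length es = n" "char_poly ?M = (\<Prod>e\<leftarrow>es. [:- e, 1:])"
    "\<And>k. mat_trace (?M ^\<^sub>m k) = (\<Sum>e\<leftarrow>es. e ^ k)"
    using real_symmetric_spectrum[OF M Msym] by blast
  define mus where "mus = map (\<lambda>e. e / c) es"
  have es_mus: "es = map ((*) c) mus" using c by (simp add: mus_def o_def map_idI)
  have pow: "(\<Sum>x\<leftarrow>mus. x ^ k) = mat_trace (?A ^\<^sub>m k)" for k
  proof -
    have "c ^ k * mat_trace (?A ^\<^sub>m k) = mat_trace (?M ^\<^sub>m k)"
      unfolding smult_pow_mat[OF A] using mat_trace_smult[of "?A ^\<^sub>m k" n] A by simp
    also have "\<dots> = c ^ k * (\<Sum>x\<leftarrow>mus. x ^ k)"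
      unfolding es(3) es_mus by (simp add: o_def power_mult_distrib sum_list_const_mult)
    finally show ?thesis using c by simp
  qed
  have evens: "(\<Sum>x\<leftarrow>mus. x ^ (2 * Suc k)) = real_of_int (square_sum (walks g k))" for k
    unfolding pow by (rule trace_adjacency_mat_even_pow[OF wf symm])
  have "(\<Sum>x\<leftarrow>mus. x\<^sup>2) = real (n * d)"
    using evens[of 0] square_sum_adj_rows[OF wf rows'] lenn by simp
  moreover have "real d \<in> set mus"
  proof -
    define v :: "real vec" where "v = vec n (\<lambda>_. 1)"
    have "?M *\<^sub>v v = (c * d) \<cdot>\<^sub>v v"
    proof (rule eq_vecI)
      fix i assume "i < dim_vec ((c * d) \<cdot>\<^sub>v v)"
      then have i: "i < n" by (simp add: v_def)
      have "set (g ! i) \<subseteq> {..<n}" "distinct (g ! i)"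
        using wf i lenn by (auto simp: well_formed_def)
      then have "(\<Sum>j<n. if j \<in> set (g ! i) then 1 else 0 :: real) = d"
        using rows[OF i] by (simp add: sum.If_cases Int_absorb1 distinct_card)
      moreover have "(?M *\<^sub>v v) $ i = c * (\<Sum>j<n. if j \<in> set (g ! i) then 1 else 0 :: real)"
        using i lenn A
        by (simp add: v_def scalar_prod_def adjacency_mat_def lessThan_atLeast0 sum_distrib_left)
      ultimately show "(?M *\<^sub>v v) $ i = ((c * d) \<cdot>\<^sub>v v) $ i"
        using i by (simp add: v_def)
    qed (use A in \<open>simp add: v_def\<close>)
    moreover have "v \<noteq> 0\<^sub>v n"
      using n by (metis index_vec index_zero_vec(1) v_def zero_neq_one)
    ultimately have "eigenvalue ?M (c * d)"
      unfolding eigenvalue_def eigenvector_def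
      using A by (intro exI[of _ v]) (auto simp: v_def)
    then have "c * d \<in> set es"
      by (auto simp: eigenvalue_root_char_poly[OF M] es(2) poly_prod_list prod_list_zero_iff)
    then show ?thesis using c by (auto simp: es_mus)
  qed
  moreover have "eso_energy G = c * (\<Sum>x\<leftarrow>mus. \<bar>x\<bar>)"
  proof -
    have "eso_energy G = matrix_energy ?M"
      unfolding eso_energy_eq[OF enum] eso_matrix_regular[OF code reg] c_def ..
    also have "\<dots> = (\<Sum>x\<leftarrow>mus. \<bar>c * x\<bar>)"
      unfolding matrix_energy_eq_sum_list[OF M es(2)] es_mus by (simp add: o_def)
    also have "\<dots> = c * (\<Sum>x\<leftarrow>mus. \<bar>x\<bar>)"
      using c by (simp add: abs_mult sum_list_const_mult)
    finally show ?thesis .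
  qed
  ultimately show ?thesis using that[of mus] es(1) evens by (simp add: mus_def c_def)
qed

section \<open>Enumeration of cubic graphs on ten vertices\<close>

text \<open>Cubic graphs are built row by row in breadth-first order. A state \<open>(rs, os, av)\<close> consists of the
finished rows \<open>rs\<close>, the queue \<open>os\<close> of the vertices that were discovered but not yet processed, each
with its already processed neighbours, and the labels \<open>av\<close> that are still free. The vertex at the
head of the queue keeps its known neighbours, is joined to some later vertices of the queue, and is
brought to degree three by fresh vertices, which take the smallest free labels. As fresh vertices
are interchangeable, no other labels need to be tried. All functions avoid recursive calls below
a \<open>\<lambda>\<close>, so that symbolic evaluation by rewriting never unfolds a call with unknown arguments.\<close>

type_synonym state = "nat list list \<times> (nat \<times> nat list) list \<times> nat list"

fun skip_vertex ::
  "nat \<times> nat list \<Rightarrow> nat list \<times> (nat \<times> nat list) list \<Rightarrow> nat list \<times> (nat \<times> nat list) list" where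
  "skip_vertex jb (S, os) = (S, jb # os)"

fun join_vertex ::
  "nat \<Rightarrow> nat \<times> nat list \<Rightarrow> nat list \<times> (nat \<times> nat list) list \<Rightarrow> nat list \<times> (nat \<times> nat list) list" where
  "join_vertex i (j, b) (S, os) = (j # S, (j, b @ [i]) # os)"

text \<open>The ways of joining vertex \<open>i\<close> to at most \<open>k\<close> queued vertices of degree less than three, each with
the queue that results.\<close>

fun link_choices ::
  "nat \<Rightarrow> nat \<Rightarrow> (nat \<times> nat list) list \<Rightarrow> (nat list \<times> (nat \<times> nat list) list) list" where
  "link_choices i 0 os = [([], os)]"
| "link_choices i (Suc k) [] = [([], [])]"
| "link_choices i (Suc k) (jb # os) = map (skip_vertex jb) (link_choices i (Suc k) os) @
     (if length (snd jb) < 3 then map (join_vertex i jb) (link_choices i k os) else [])"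

fun finish_row ::
  "nat list list \<Rightarrow> nat \<Rightarrow> nat list \<Rightarrow> nat list \<Rightarrow> nat list \<times> (nat \<times> nat list) list \<Rightarrow> state list" where
  "finish_row rs i b av (S, os) = (let k = 3 - length (b @ S) in
     if k \<le> length av
     then [(rs @ [b @ S @ take k av], os @ map (\<lambda>j. (j, [i])) (take k av), drop k av)]
     else [])"

fun expand :: "nat list list \<Rightarrow> (nat \<times> nat list) list \<Rightarrow> nat list \<Rightarrow> state list" where
  "expand rs [] av = []"
| "expand rs ((i, b) # os) av = concat (map (finish_row rs i b av) (link_choices i (3 - length b) os))"

fun next_states :: "state \<Rightarrow> state list" where
  "next_states (rs, [], []) = []"
| \<comment> \<open>An empty queue means that a component is complete; a free label starts the next one.\<close>
  "next_states (rs, [], v # av) = expand rs [(v, [])] av"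
| "next_states (rs, ib # os, av) = expand rs (ib # os) av"

primrec every_completion :: "(nat list list \<Rightarrow> bool) \<Rightarrow> nat \<Rightarrow> state \<Rightarrow> bool" where
  "every_completion P 0 s = P (fst s)"
| "every_completion P (Suc f) s = list_all (every_completion P f) (next_states s)"

definition lower_neighbours :: "nat list list \<Rightarrow> nat \<Rightarrow> nat list" where
  "lower_neighbours rs j = filter (\<lambda>i. j \<in> set (rs ! i)) [0..<length rs]"

text \<open>A state is determined by its finished rows and the number \<open>m\<close> of discovered vertices.\<close>

definition search_state :: "nat list list \<Rightarrow> nat \<Rightarrow> state" where
  "search_state rs m = (rs, map (\<lambda>j. (j, lower_neighbours rs j)) [length rs..<m], [m..<10])"

lemma lower_neighbours_snoc:
  "lower_neighbours (rs @ [r]) j = lower_neighbours rs j @ (if j \<in> set r then [length rs] else [])"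
  by (auto simp: lower_neighbours_def nth_append intro!: filter_cong)

lemma link_choices_filter:
  assumes "length (filter p js) \<le> k" "\<forall>j\<in>set js. p j \<longrightarrow> length (low j) < 3"
  shows "(filter p js, map (\<lambda>j. (j, low j @ (if p j then [i] else []))) js)
    \<in> set (link_choices i k (map (\<lambda>j. (j, low j)) js))"
  using assms
proof (induction js arbitrary: k)
  case Nil
  then show ?case by (cases k) auto
next
  case (Cons j js)
  show ?case
  proof (cases k)
    case 0
    then have "\<forall>l\<in>set (j # js). \<not> p l" using Cons.prems(1) by (simp add: filter_empty_conv split: if_splits)
    then show ?thesis using 0 by (auto simp: filter_empty_conv)
  next
    case (Suc k')
    show ?thesis
    proof (cases "p j")
      case True
      with Cons.prems Suc have "(filter p js, map (\<lambda>j. (j, low j @ (if p j then [i] else []))) js)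
          \<in> set (link_choices i k' (map (\<lambda>j. (j, low j)) js))" by (intro Cons.IH) auto
      from imageI[OF this, of "join_vertex i (j, low j)"] show ?thesis
        using Suc True Cons.prems(2) by auto
    next
      case False
      with Cons.prems Suc have "(filter p js, map (\<lambda>j. (j, low j @ (if p j then [i] else []))) js)
          \<in> set (link_choices i k (map (\<lambda>j. (j, low j)) js))" by (intro Cons.IH) auto
      from imageI[OF this, of "skip_vertex (j, low j)"] show ?thesis
        using Suc False by auto
    qed
  qed
qed

text \<open>For a vertex that starts a new component, \<open>m0 = length rs\<close> and that vertex itself has to be counted
as discovered; this is the maximum in the second assumption.\<close>

lemma search_state_child:
  fixes p :: "nat \<Rightarrow> bool" and rs :: "nat list list" and m0 m k :: nat
  defines "b \<equiv> lower_neighbours rs (length rs)" and "S \<equiv> filter p [Suc (length rs)..<m]"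
  assumes rs: "length rs \<le> m0" "m = max m0 (Suc (length rs))" "\<forall>r\<in>set rs. set r \<subseteq> {..<m0}"
    and S: "\<forall>j\<in>set S. length (lower_neighbours rs j) < 3"
    and k: "length (b @ S) + k = 3" "m + k \<le> 10"
  shows "search_state (rs @ [b @ S @ [m..<m + k]]) (m + k) \<in> set (next_states (search_state rs m0))"
proof -
  define i where "i = length rs"
  define os where "os = map (\<lambda>j. (j, lower_neighbours rs j)) [Suc i..<m]"
  define row where "row = b @ S @ [m..<m + k]"
  have im: "i < m" using rs by (simp add: i_def)
  have high: "lower_neighbours rs j = []" if "m0 \<le> j" for j
    using rs(3) that by (fastforce simp: lower_neighbours_def filter_empty_conv)
  have b: "set b \<subseteq> {..<i}" by (auto simp: b_def lower_neighbours_def i_def)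
  have ch: "next_states (search_state rs m0) = expand rs ((i, b) # os) [m..<10]"
  proof (cases "i < m0")
    case True
    then show ?thesis using rs
      by (simp add: search_state_def os_def b_def i_def upt_conv_Cons max_absorb1)
  next
    case False
    then have "m0 = i" "m = Suc i" using rs by (auto simp: i_def)
    then show ?thesis using k high[of i] b_def
      by (simp add: search_state_def os_def i_def upt_conv_Cons)
  qed
  have rowj: "j \<in> set row \<longleftrightarrow> p j" if "Suc i \<le> j" "j < m" for j
    using that b by (auto simp: row_def S_def i_def)
  have "(S, map (\<lambda>j. (j, lower_neighbours rs j @ (if p j then [i] else []))) [Suc i..<m])
      \<in> set (link_choices i (3 - length b) os)"
    unfolding S_def os_def i_def
    by (rule link_choices_filter) (use S k in \<open>auto simp: S_def\<close>)
  moreover have "map (\<lambda>j. (j, lower_neighbours rs j @ (if p j then [i] else []))) [Suc i..<m]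
      = map (\<lambda>j. (j, lower_neighbours (rs @ [row]) j)) [Suc i..<m]"
    using rowj by (auto simp: lower_neighbours_snoc i_def)
  moreover have "map (\<lambda>j. (j, [i])) [m..<m + k] = map (\<lambda>j. (j, lower_neighbours (rs @ [row]) j)) [m..<m + k]"
    using rs high by (auto simp: lower_neighbours_snoc i_def row_def)
  moreover have "search_state (rs @ [row]) (m + k) =
      (rs @ [row], map (\<lambda>j. (j, lower_neighbours (rs @ [row]) j)) ([Suc i..<m] @ [m..<m + k]), [m + k..<10])"
    using im by (simp add: search_state_def i_def upt_add_eq_append[symmetric] del: upt_Suc)
  moreover have "take k [m..<10] = [m..<m + k]" "drop k [m..<10] = [m + k..<10]"
    using k(2) by (simp_all add: take_upt drop_upt)
  moreover have "3 - length (b @ S) = k" using k(1) by simp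
  ultimately show ?thesis
    unfolding ch row_def[symmetric] using k(2)
    by (auto simp: Let_def row_def intro!: bexI)
qed

text \<open>The state of knowledge in the middle of the search: the vertices \<open>vs\<close> have been discovered, in this
order, and the first \<open>length rs\<close> of them have been processed. Since all neighbours of a processed
vertex are discovered, its row never changes when \<open>vs\<close> grows.\<close>

definition partial_adj_list :: "'a pair_pre_digraph \<Rightarrow> 'a list \<Rightarrow> nat list list \<Rightarrow> bool" where
  "partial_adj_list G vs rs \<longleftrightarrow> distinct vs \<and> set vs \<subseteq> pverts G \<and> length rs \<le> length vs \<and>
     (\<forall>i<length rs. distinct (rs ! i) \<and> set (rs ! i) = {j. j < length vs \<and> (vs ! i, vs ! j) \<in> parcs G}
        \<and> neighbours G (vs ! i) \<subseteq> set vs)"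

lemma partial_adj_list_append:
  assumes pc: "partial_adj_list G vs rs" and ns: "distinct (vs @ ns)" "set ns \<subseteq> pverts G"
  shows "partial_adj_list G (vs @ ns) rs"
proof -
  have "set (rs ! i) = {j. j < length (vs @ ns) \<and> ((vs @ ns) ! i, (vs @ ns) ! j) \<in> parcs G}"
    and "neighbours G ((vs @ ns) ! i) \<subseteq> set (vs @ ns)" if i: "i < length rs" for i
  proof -
    have i': "(vs @ ns) ! i = vs ! i" and sub: "neighbours G (vs ! i) \<subseteq> set vs"
      and r: "set (rs ! i) = {j. j < length vs \<and> (vs ! i, vs ! j) \<in> parcs G}"
      using pc i by (auto simp: partial_adj_list_def nth_append)
    show "neighbours G ((vs @ ns) ! i) \<subseteq> set (vs @ ns)" using sub i' by auto
    have lt: "j < length vs" if j: "j < length (vs @ ns)" "(vs ! i, (vs @ ns) ! j) \<in> parcs G" for j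
    proof (rule ccontr)
      assume "\<not> j < length vs"
      then have "(vs @ ns) ! j \<in> set ns" using j(1) by (simp add: nth_append)
      moreover have "(vs @ ns) ! j \<in> set vs" using sub j(2) by (auto simp: neighbours_def)
      ultimately show False using ns(1) by auto
    qed
    have "j < length (vs @ ns) \<and> (vs ! i, (vs @ ns) ! j) \<in> parcs G \<longleftrightarrow>
        j < length vs \<and> (vs ! i, vs ! j) \<in> parcs G" for j
    proof (cases "j < length vs")
      case True then show ?thesis by (simp add: nth_append)
    next
      case False then show ?thesis using lt[of j] by blast
    qed
    then show "set (rs ! i) = {j. j < length (vs @ ns) \<and> ((vs @ ns) ! i, (vs @ ns) ! j) \<in> parcs G}"
      unfolding r i' by simp
  qed
  then show ?thesis using pc ns by (simp add: partial_adj_list_def)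
qed

lemma set_lower_neighbours:
  assumes pc: "partial_adj_list G vs rs" and G: "pair_graph G" and j: "j < length vs"
  shows "set (lower_neighbours rs j) = {i. i < length rs \<and> (vs ! j, vs ! i) \<in> parcs G}"
    and "distinct (lower_neighbours rs j)"
proof -
  show "set (lower_neighbours rs j) = {i. i < length rs \<and> (vs ! j, vs ! i) \<in> parcs G}"
    using pc j pair_graph_sym[OF G] by (auto simp: lower_neighbours_def partial_adj_list_def)
qed (simp add: lower_neighbours_def)

lemma index_card_neighbours:
  assumes vs: "distinct vs" and J: "J \<subseteq> {j. j < length vs \<and> (u, vs ! j) \<in> parcs G}"
  shows "card ((!) vs ` J) = card J" "(!) vs ` J \<subseteq> neighbours G u"
proof -
  have "inj_on ((!) vs) J" using nth_eq_iff_index_eq[OF vs] J by (auto simp: inj_on_def subset_iff)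
  then show "card ((!) vs ` J) = card J" by (rule card_image)
  show "(!) vs ` J \<subseteq> neighbours G u" using J by (auto simp: neighbours_def)
qed

lemma index_card_le:
  assumes "distinct vs" "J \<subseteq> {j. j < length vs \<and> (u, vs ! j) \<in> parcs G}" "finite (neighbours G u)"
  shows "card J \<le> card (neighbours G u)"
  using index_card_neighbours[OF assms(1,2)] card_mono[OF assms(3)] by metis

text \<open>The search does not choose the labelling; it is the proof that chooses, along the given graph. It
picks a vertex outside \<open>vs\<close> if the queue is empty, appends the undiscovered neighbours of the
current vertex in any order, and observes that the row obtained is among those tried by the
search.\<close>

theorem every_completion_complete:
  assumes G: "G \<in> regular_graphs 3 10"
  shows "partial_adj_list G vs rs \<Longrightarrow> length rs + f = 10 \<Longrightarrow> every_completion P f (search_state rs (length vs)) \<Longrightarrow>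
    \<exists>ws g. is_adj_list G ws g \<and> P g"
proof (induction f arbitrary: vs rs)
  case 0
  have pg: "pair_graph G" and card: "card (pverts G) = 10" using G by (auto simp: regular_graphs_def)
  have fin: "finite (pverts G)" using card by (metis card.infinite zero_neq_numeral)
  have vs: "distinct vs" "set vs \<subseteq> pverts G" "length vs \<ge> 10"
    using 0 by (auto simp: partial_adj_list_def)
  have "card (set vs) = length vs" using vs(1) by (rule distinct_card)
  moreover have "card (set vs) \<le> 10" using card_mono[OF fin vs(2)] card by simp
  ultimately have len: "length vs = 10" using vs(3) by simp
  then have "set vs = pverts G"
    using card_subset_eq[OF fin vs(2)] card \<open>card (set vs) = length vs\<close> by simp
  then have "is_adj_list G vs rs"
    using 0 len by (auto simp: is_adj_list_def partial_adj_list_def is_vertex_enum_def)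
  then show ?case using 0 by (auto simp: search_state_def)
next
  case (Suc f)
  have pg: "pair_graph G" and card: "card (pverts G) = 10"
    and deg: "\<And>v. v \<in> pverts G \<Longrightarrow> card (neighbours G v) = 3"
    using G by (auto simp: regular_graphs_def degree_of_eq_card_neighbours)
  have fin: "finite (pverts G)" using card by (metis card.infinite zero_neq_numeral)
  have finN: "finite (neighbours G u)" for u
    using pair_graph_neighbours_subset[OF pg] fin by (rule finite_subset)
  define i where "i = length rs"
  have i10: "i < 10" using Suc.prems by (simp add: i_def)
  obtain ws where ws: "partial_adj_list G ws rs" "length ws = max (length vs) (Suc i)"
  proof (cases "i < length vs")
    case True
    then show ?thesis using that[of vs] Suc.prems by simp
  next
    case False
    then have len: "length vs = i" using Suc.prems by (simp add: partial_adj_list_def i_def)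
    have "card (set vs) = i" using Suc.prems len by (simp add: partial_adj_list_def distinct_card)
    then have "\<not> pverts G \<subseteq> set vs" using card_mono[of "set vs" "pverts G"] card i10 by auto
    then obtain v where v: "v \<in> pverts G" "v \<notin> set vs" by blast
    have "partial_adj_list G (vs @ [v]) rs"
      by (rule partial_adj_list_append) (use Suc.prems v in \<open>auto simp: partial_adj_list_def\<close>)
    then show ?thesis using that[of "vs @ [v]"] len by simp
  qed
  define m where "m = length ws"
  have im: "i < m" using ws(2) by (simp add: m_def)
  have dws: "distinct ws" "set ws \<subseteq> pverts G" using ws(1) by (auto simp: partial_adj_list_def)
  define u where "u = ws ! i"
  have u: "u \<in> pverts G" using dws im by (auto simp: u_def m_def)
  define b where "b = lower_neighbours rs i"
  define S where "S = filter (\<lambda>j. (u, ws ! j) \<in> parcs G) [Suc i..<m]"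
  define r where "r = b @ S"
  define k where "k = 3 - length r"
  have b: "set b = {j. j < i \<and> (u, ws ! j) \<in> parcs G}" "distinct b"
    using set_lower_neighbours[OF ws(1) pg, of i] im by (simp_all add: b_def u_def i_def m_def)
  have S: "set S = {j. i < j \<and> j < m \<and> (u, ws ! j) \<in> parcs G}" "distinct S"
    by (auto simp: S_def)
  have low3: "\<forall>j\<in>set S. length (lower_neighbours rs j) < 3"
  proof -
    \<comment> \<open>A later neighbour of the current vertex has one neighbour more than its processed ones.\<close>
    have "length (lower_neighbours rs j) < 3" if j: "i < j" "j < m" "(u, ws ! j) \<in> parcs G" for j
    proof -
      have low: "set (lower_neighbours rs j) = {l. l < i \<and> (ws ! j, ws ! l) \<in> parcs G}" "distinct (lower_neighbours rs j)"
        using set_lower_neighbours[OF ws(1) pg, of j] j(2) by (simp_all add: i_def m_def)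
      have "card (insert i (set (lower_neighbours rs j))) \<le> card (neighbours G (ws ! j))"
        using j im pair_graph_sym[OF pg j(3)]
        by (intro index_card_le[OF dws(1) _ finN]) (auto simp: low(1) m_def u_def)
      also have "\<dots> = 3"
        using deg[of "ws ! j"] dws(2) nth_mem[of j ws] j(2) unfolding m_def by blast
      finally show ?thesis by (simp add: low(1) distinct_card[OF low(2), symmetric])
    qed
    then show ?thesis by (auto simp: S(1))
  qed
  have r: "distinct r" "set r = {j. j < m \<and> (u, ws ! j) \<in> parcs G}"
  proof -
    have "set b \<inter> set S = {}" unfolding b(1) S(1) by auto
    then show "distinct r" unfolding r_def using b(2) S(2) by simp
    have "j \<in> set b \<or> j \<in> set S \<longleftrightarrow> j < m \<and> (u, ws ! j) \<in> parcs G" for j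
      unfolding b(1) S(1) using im pair_graph_loopfree[OF pg, of u]
      by (cases j i rule: linorder_cases) (simp_all add: u_def)
    then show "set r = {j. j < m \<and> (u, ws ! j) \<in> parcs G}"
      unfolding r_def set_append by blast
  qed
  have img: "(!) ws ` set r = neighbours G u \<inter> set ws"
    unfolding r(2) neighbours_def m_def by (auto simp: in_set_conv_nth)
  have "card ((!) ws ` set r) = card (set r)"
    by (rule index_card_neighbours(1)[OF dws(1), of _ u G]) (simp add: r(2) m_def)
  then have card_r: "card (neighbours G u \<inter> set ws) = length r"
    by (simp only: img distinct_card[OF r(1)])
  have len_r: "length r \<le> 3"
    using card_mono[OF finN, of "neighbours G u \<inter> set ws" u] card_r deg[OF u] by simp
  obtain ns where ns: "distinct ns" "set ns = neighbours G u - set ws"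
    using finite_distinct_list[of "neighbours G u - set ws"] finN by auto
  have len_ns: "length ns = k"
    using ns card_r deg[OF u] card_Diff_subset_Int[of "neighbours G u" "set ws"]
    by (simp add: k_def distinct_card[symmetric])
  define xs where "xs = ws @ ns"
  have xs: "distinct xs" "set xs \<subseteq> pverts G" "length xs = m + k"
    using dws ns len_ns pair_graph_neighbours_subset[OF pg, of u] by (auto simp: xs_def m_def)
  have mk: "m + k \<le> 10"
    using card_mono[OF fin xs(2)] card xs distinct_card[OF xs(1)] by simp
  have "search_state (rs @ [r @ [m..<m + k]]) (length xs) \<in> set (next_states (search_state rs (length vs)))"
    unfolding xs(3) r_def b_def S_def i_def append_assoc
  proof (rule search_state_child)
    show "length rs \<le> length vs" "\<forall>r\<in>set rs. set r \<subseteq> {..<length vs}"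
      using Suc.prems(1) unfolding partial_adj_list_def all_set_conv_all_nth by auto
    show "m = max (length vs) (Suc (length rs))" using ws(2) by (simp add: m_def i_def)
  qed (use low3 len_r mk in \<open>simp_all add: k_def r_def b_def S_def i_def\<close>)
  then have step: "every_completion P f (search_state (rs @ [r @ [m..<m + k]]) (length xs))"
    using Suc.prems(3) by (simp add: list_all_iff)
  have pc: "partial_adj_list G xs rs"
    unfolding xs_def by (rule partial_adj_list_append[OF ws(1)]) (use xs in \<open>auto simp: xs_def\<close>)
  have xsi: "xs ! i = u" using im by (simp add: xs_def u_def m_def nth_append)
  have row: "distinct (r @ [m..<m + k])"
    "set (r @ [m..<m + k]) = {j. j < length xs \<and> (xs ! i, xs ! j) \<in> parcs G}"
    "neighbours G (xs ! i) \<subseteq> set xs"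
  proof -
    have "set r \<inter> set [m..<m + k] = {}" unfolding r(2) by auto
    then show "distinct (r @ [m..<m + k])" using r(1) by simp
    have new: "(u, xs ! j) \<in> parcs G" if "m \<le> j" "j < m + k" for j
    proof -
      have "xs ! j \<in> set ns" using that len_ns by (simp add: xs_def m_def nth_append)
      then show ?thesis using ns by (simp add: neighbours_def)
    qed
    have "j \<in> set (r @ [m..<m + k]) \<longleftrightarrow> j < m + k \<and> (u, xs ! j) \<in> parcs G" for j
    proof (cases "j < m")
      case True
      then have "xs ! j = ws ! j" by (simp add: xs_def m_def nth_append)
      then show ?thesis using True unfolding set_append r(2) by simp
    next
      case False
      then show ?thesis using new[of j] unfolding set_append r(2) by auto
    qed
    then show "set (r @ [m..<m + k]) = {j. j < length xs \<and> (xs ! i, xs ! j) \<in> parcs G}"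
      unfolding xsi xs(3) by blast
    show "neighbours G (xs ! i) \<subseteq> set xs" unfolding xsi using ns by (auto simp: xs_def)
  qed
  have "partial_adj_list G xs (rs @ [r @ [m..<m + k]])"
    unfolding partial_adj_list_def
  proof (intro conjI allI impI)
    show "length (rs @ [r @ [m..<m + k]]) \<le> length xs" using im xs(3) by (simp add: i_def)
  next
    fix l assume "l < length (rs @ [r @ [m..<m + k]])"
    then consider "l < length rs" | "l = i" by (auto simp: i_def less_Suc_eq)
    then have *: "distinct ((rs @ [r @ [m..<m + k]]) ! l) \<and>
      set ((rs @ [r @ [m..<m + k]]) ! l) = {j. j < length xs \<and> (xs ! l, xs ! j) \<in> parcs G} \<and>
      neighbours G (xs ! l) \<subseteq> set xs"
    proof cases
      case 1
      then have nth: "(rs @ [r @ [m..<m + k]]) ! l = rs ! l" by (simp add: nth_append)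
      show ?thesis unfolding nth using pc 1 unfolding partial_adj_list_def by blast
    next
      case 2
      have nth: "(rs @ [r @ [m..<m + k]]) ! i = r @ [m..<m + k]" by (simp add: i_def)
      show ?thesis unfolding 2 nth by (intro conjI row)
    qed
    show "distinct ((rs @ [r @ [m..<m + k]]) ! l)" by (rule *[THEN conjunct1])
    show "set ((rs @ [r @ [m..<m + k]]) ! l) = {j. j < length xs \<and> (xs ! l, xs ! j) \<in> parcs G}"
      by (rule *[THEN conjunct2, THEN conjunct1])
    show "neighbours G (xs ! l) \<subseteq> set xs" by (rule *[THEN conjunct2, THEN conjunct2])
  qed (rule xs(1), rule xs(2))
  moreover have "length (rs @ [r @ [m..<m + k]]) + f = 10" using Suc.prems(2) by simp
  ultimately show ?case using Suc.IH step by blast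
qed

section \<open>The largest energy\<close>

text \<open>The disjuncts are the hypotheses of the two estimates by majorants. The second one is needed for
four of the 21 cubic graphs on ten vertices: two bipartite graphs and the two disconnected ones.\<close>

definition few_closed_walks :: "nat list list \<Rightarrow> bool" where
  "few_closed_walks g = (let W2 = extend_walks g (adj_rows g); W3 = extend_walks g W2;
     w4 = square_sum W2; w6 = square_sum W3
   in w6 - 12 * w4 \<le> -810 \<or> w6 - 23 * w4 \<le> -2616)"

lemma every_cubic_adj_list: "every_completion few_closed_walks 10 ([], [], [0..<10])"
  by code_simp

lemma cubic_energy_le:
  assumes G: "G \<in> regular_graphs 3 10"
  shows "eso_energy G \<le> eso_weight 3 * 16"
proof -
  have "partial_adj_list G [] []" by (simp add: partial_adj_list_def)
  moreover have "every_completion few_closed_walks 10 (search_state [] (length []))"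
    using every_cubic_adj_list by (simp add: search_state_def)
  ultimately obtain vs g where code: "is_adj_list G vs g" and low: "few_closed_walks g"
    using every_completion_complete[OF G, of "[]" "[]" 10 few_closed_walks] by auto
  obtain mus where mus: "length mus = 10" "real 3 \<in> set mus" "(\<Sum>x\<leftarrow>mus. x\<^sup>2) = real (10 * 3)"
    "\<And>k. (\<Sum>x\<leftarrow>mus. x ^ (2 * Suc k)) = real_of_int (square_sum (walks g k))"
    "eso_energy G = eso_weight 3 * (\<Sum>x\<leftarrow>mus. \<bar>x\<bar>)"
    using regular_graph_energy[OF G _ _ code] by auto
  define w4 where "w4 = square_sum (walks g 1)"
  define w6 where "w6 = square_sum (walks g 2)"
  have w: "(\<Sum>x\<leftarrow>mus. x ^ 4) = real_of_int w4" "(\<Sum>x\<leftarrow>mus. x ^ 6) = real_of_int w6"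
    using mus(4)[of 1] mus(4)[of 2] by (simp_all add: w4_def w6_def)
  have "w6 - 12 * w4 \<le> -810 \<or> w6 - 23 * w4 \<le> -2616"
    using low by (simp add: few_closed_walks_def w4_def w6_def Let_def numeral_2_eq_2)
  then have "real_of_int w6 - 12 * real_of_int w4 \<le> -810 \<or> real_of_int w6 - 23 * real_of_int w4 \<le> -2616"
    by linarith
  then have "(\<Sum>x\<leftarrow>mus. \<bar>x\<bar>) \<le> 16"
    using sum_abs_le_16_except_3[of mus] sum_abs_le_16[of mus] mus(1-3) w by auto
  then show ?thesis unfolding mus(5) using eso_weight_pos[of 3] by (intro mult_left_mono) auto
qed

lemma cubic_energy_eq:
  assumes G: "G \<in> regular_graphs 3 10" and code: "is_adj_list G vs g"
    and w: "map (\<lambda>k. square_sum (walks g k)) [1, 2, 3] = [150, 990, 7590]"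
  shows "eso_energy G = eso_weight 3 * 16"
proof -
  obtain mus where mus: "length mus = 10" "real 3 \<in> set mus" "(\<Sum>x\<leftarrow>mus. x\<^sup>2) = real (10 * 3)"
    "\<And>k. (\<Sum>x\<leftarrow>mus. x ^ (2 * Suc k)) = real_of_int (square_sum (walks g k))"
    "eso_energy G = eso_weight 3 * (\<Sum>x\<leftarrow>mus. \<bar>x\<bar>)"
    using regular_graph_energy[OF G _ _ code] by auto
  have "(\<Sum>x\<leftarrow>mus. x ^ 4) = 150" "(\<Sum>x\<leftarrow>mus. x ^ 6) = 990" "(\<Sum>x\<leftarrow>mus. x ^ 8) = 7590"
    using mus(4)[of 1] mus(4)[of 2] mus(4)[of 3] w by simp_all
  then have "(\<Sum>x\<leftarrow>mus. \<bar>x\<bar>) = 16"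
    using mus(1-3) by (intro sum_abs_eq_16) auto
  then show ?thesis unfolding mus(5) by simp
qed

section \<open>The Petersen graph and its petersen_mate\<close>

definition regular_adj_list :: "nat \<Rightarrow> nat list list \<Rightarrow> bool" where
  "regular_adj_list d g \<longleftrightarrow> (\<forall>i<length g. distinct (g ! i) \<and> length (g ! i) = d \<and> i \<notin> set (g ! i)
     \<and> (\<forall>j\<in>set (g ! i). j < length g \<and> i \<in> set (g ! j)))"

definition labelled_graph :: "(nat \<Rightarrow> 'a) \<Rightarrow> nat list list \<Rightarrow> 'a pair_pre_digraph" where
  "labelled_graph f g = \<lparr>pverts = f ` {..<length g}, parcs = {(f i, f j) | i j. i < length g \<and> j \<in> set (g ! i)}\<rparr>"

lemma labelled_graph_regular:
  assumes g: "regular_adj_list d g" and f: "inj_on f {..<length g}"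
  shows "labelled_graph f g \<in> regular_graphs d (length g)"
    and "is_adj_list (labelled_graph f g) (map f [0..<length g]) g"
proof -
  let ?G = "labelled_graph f g" and ?n = "length g"
  have row: "distinct (g ! i)" "length (g ! i) = d" "i \<notin> set (g ! i)"
    "j \<in> set (g ! i) \<Longrightarrow> j < ?n" "j \<in> set (g ! i) \<Longrightarrow> i \<in> set (g ! j)" if "i < ?n" for i j
  proof -
    have "distinct (g ! i) \<and> length (g ! i) = d \<and> i \<notin> set (g ! i)
        \<and> (\<forall>j\<in>set (g ! i). j < ?n \<and> i \<in> set (g ! j))"
      using g that unfolding regular_adj_list_def by blast
    then show "distinct (g ! i)" "length (g ! i) = d" "i \<notin> set (g ! i)"
      "j \<in> set (g ! i) \<Longrightarrow> j < ?n" "j \<in> set (g ! i) \<Longrightarrow> i \<in> set (g ! j)" by blast+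
  qed
  have arc: "(f i, f j) \<in> parcs ?G \<longleftrightarrow> j \<in> set (g ! i)" if ij: "i < ?n" "j < ?n" for i j
  proof
    assume "(f i, f j) \<in> parcs ?G"
    then obtain i' j' where "f i = f i'" "f j = f j'" "i' < ?n" "j' \<in> set (g ! i')"
      by (auto simp: labelled_graph_def)
    moreover from this have "i = i'" "j = j'" using ij row(4)[of i' j'] by (auto intro: inj_onD[OF f])
    ultimately show "j \<in> set (g ! i)" by simp
  qed (use ij in \<open>auto simp: labelled_graph_def\<close>)
  show code: "is_adj_list ?G (map f [0..<?n]) g"
  proof -
    have "set (g ! i) = {j. j < ?n \<and> (f i, f j) \<in> parcs ?G}" if "i < ?n" for i
      using arc[OF that] row(4)[OF that] by blast
    moreover have "pverts ?G = f ` {..<?n}" by (simp add: labelled_graph_def)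
    ultimately show ?thesis
      using f row(1) by (auto simp: is_adj_list_def is_vertex_enum_def distinct_map lessThan_atLeast0)
  qed
  have "parcs ?G \<subseteq> f ` {..<?n} \<times> f ` {..<?n}"
    using row(4) by (auto simp: labelled_graph_def)
  then have fin: "finite (parcs ?G)" by (rule finite_subset) simp
  have pg: "pair_graph ?G"
  proof (unfold_locales)
    show "finite (parcs ?G)" by (rule fin)
    show "symmetric (with_proj ?G)"
      unfolding symmetric_def with_proj_simps
    proof (rule symI)
      fix u v assume "(u, v) \<in> parcs ?G"
      then obtain i j where ij: "u = f i" "v = f j" "i < ?n" "j \<in> set (g ! i)"
        unfolding labelled_graph_def by auto
      then show "(v, u) \<in> parcs ?G"
        using arc[of j i] row(4,5)[of i j] by simp
    qed
  next
    fix e assume e: "e \<in> parcs ?G"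
    then obtain i j where ij: "e = (f i, f j)" "i < ?n" "j \<in> set (g ! i)"
      by (auto simp: labelled_graph_def)
    then show "fst e \<in> pverts ?G" "snd e \<in> pverts ?G" using row(4) by (auto simp: labelled_graph_def)
    show "fst e \<noteq> snd e"
      using ij row(3,4)[of i] f by (auto simp: inj_on_def)
  qed (auto simp: labelled_graph_def)
  moreover have "card (pverts ?G) = ?n" using f by (simp add: labelled_graph_def card_image)
  moreover have "degree_of ?G v = d" if v: "v \<in> pverts ?G" for v
  proof -
    obtain i where i: "i < ?n" "v = f i" using v by (auto simp: labelled_graph_def)
    then show ?thesis using is_adj_list_length_row[OF code pg i(1)] row(2) by simp
  qed
  ultimately show "?G \<in> regular_graphs d ?n" by (simp add: regular_graphs_def)
qed

definition petersen_labels :: "nat set list" where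
  "petersen_labels = [{0,1}, {0,2}, {0,3}, {0,4}, {1,2}, {1,3}, {1,4}, {2,3}, {2,4}, {3,4}]"

definition petersen_adj_list :: "nat list list" where
  "petersen_adj_list = [[7,8,9], [5,6,9], [4,6,8], [4,5,7], [2,3,9], [1,3,8], [1,2,7], [0,3,6], [0,2,5], [0,1,4]]"

text \<open>A cubic graph with the two triangles \<open>0, 1, 2\<close> and \<open>7, 8, 9\<close> and no 4-cycle.\<close>

definition petersen_mate_adj_list :: "nat list list" where
  "petersen_mate_adj_list = [[1,2,3], [0,2,4], [0,1,5], [0,6,7], [1,6,8], [2,6,9], [3,4,5], [3,8,9], [4,7,9], [5,7,8]]"

lemma petersen_vertices: "{S. S \<subseteq> {0..<5} \<and> card S = 2} = set petersen_labels"
proof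
  show "set petersen_labels \<subseteq> {S. S \<subseteq> {0..<5} \<and> card S = 2}"
    by (simp add: petersen_labels_def)
  show "{S. S \<subseteq> {0..<5} \<and> card S = 2} \<subseteq> set petersen_labels"
  proof
    fix S :: "nat set" assume "S \<in> {S. S \<subseteq> {0..<5} \<and> card S = 2}"
    then obtain x y where S: "S = {x, y}" "x \<noteq> y" "x < 5" "y < 5" by (auto simp: card_2_iff)
    moreover have "\<forall>x<5. \<forall>y<5. x \<noteq> y \<longrightarrow> {x, y} \<in> set petersen_labels"
      by (simp add: All_less_Suc eval_nat_numeral petersen_labels_def doubleton_eq_iff)
    ultimately show "S \<in> set petersen_labels" by blast
  qed
qed

lemma petersen_adjacency:
  "\<forall>i<10. \<forall>j<10. petersen_labels ! i \<inter> petersen_labels ! j = {} \<longleftrightarrow> j \<in> set (petersen_adj_list ! i)"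
  by (simp add: All_less_Suc eval_nat_numeral petersen_labels_def petersen_adj_list_def)

lemma petersen_eq_labelled_graph: "petersen = labelled_graph ((!) petersen_labels) petersen_adj_list"
proof -
  have len: "length petersen_labels = 10" "length petersen_adj_list = 10"
    by (simp_all add: petersen_labels_def petersen_adj_list_def)
  have V: "set petersen_labels = (!) petersen_labels ` {..<10}"
    using len by (auto simp: set_conv_nth)
  have rows: "\<forall>i<10. set (petersen_adj_list ! i) \<subseteq> {..<10}"
    by (simp add: All_less_Suc eval_nat_numeral petersen_adj_list_def)
  show ?thesis
    unfolding petersen_def petersen_vertices labelled_graph_def Let_def len V
    using petersen_adjacency rows by fastforce
qed

lemma petersen_regular: "petersen \<in> regular_graphs 3 10"
  and petersen_is_adj_list: "is_adj_list petersen (map ((!) petersen_labels) [0..<10]) petersen_adj_list"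
proof -
  have len: "length petersen_adj_list = 10" by (simp add: petersen_adj_list_def)
  have "regular_adj_list 3 petersen_adj_list"
    by (simp add: regular_adj_list_def All_less_Suc eval_nat_numeral petersen_adj_list_def)
  moreover have "distinct petersen_labels"
    by (auto simp: petersen_labels_def doubleton_eq_iff)
  then have "inj_on ((!) petersen_labels) {..<length petersen_adj_list}"
    by (intro inj_on_nth) (simp_all add: petersen_labels_def petersen_adj_list_def)
  ultimately show "petersen \<in> regular_graphs 3 10"
    and "is_adj_list petersen (map ((!) petersen_labels) [0..<10]) petersen_adj_list"
    using labelled_graph_regular[of 3 petersen_adj_list "(!) petersen_labels"] len
    by (simp_all add: petersen_eq_labelled_graph)
qed

lemma petersen_energy: "eso_energy petersen = eso_weight 3 * 16"
proof (rule cubic_energy_eq[OF petersen_regular petersen_is_adj_list])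
  show "map (\<lambda>k. square_sum (walks petersen_adj_list k)) [1, 2, 3] = [150, 990, 7590]" by code_simp
qed

definition petersen_mate :: "nat set pair_pre_digraph" where
  "petersen_mate = labelled_graph (\<lambda>i. {i}) petersen_mate_adj_list"

lemma petersen_mate_regular: "petersen_mate \<in> regular_graphs 3 10"
  and petersen_mate_is_adj_list: "is_adj_list petersen_mate (map (\<lambda>i. {i}) [0..<10]) petersen_mate_adj_list"
proof -
  have "regular_adj_list 3 petersen_mate_adj_list"
    by (simp add: regular_adj_list_def All_less_Suc eval_nat_numeral petersen_mate_adj_list_def)
  moreover have "length petersen_mate_adj_list = 10" by (simp add: petersen_mate_adj_list_def)
  ultimately show "petersen_mate \<in> regular_graphs 3 10" "is_adj_list petersen_mate (map (\<lambda>i. {i}) [0..<10]) petersen_mate_adj_list"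
    using labelled_graph_regular[of 3 petersen_mate_adj_list "\<lambda>i. {i}"] by (simp_all add: petersen_mate_def)
qed

lemma petersen_mate_energy: "eso_energy petersen_mate = eso_weight 3 * 16"
proof (rule cubic_energy_eq[OF petersen_mate_regular petersen_mate_is_adj_list])
  show "map (\<lambda>k. square_sum (walks petersen_mate_adj_list k)) [1, 2, 3] = [150, 990, 7590]" by code_simp
qed

lemma graph_iso_imp_hom:
  assumes "graph_iso G H"
  obtains h where "\<And>u v. (u, v) \<in> parcs G \<Longrightarrow> (h u, h v) \<in> parcs H"
proof -
  obtain f where f: "pre_digraph.digraph_isomorphism (with_proj G) f" "with_proj H = app_iso f (with_proj G)"
    using assms by (auto simp: graph_iso_def digraph_iso_def)
  have "(iso_verts f u, iso_verts f v) \<in> parcs H" if uv: "(u, v) \<in> parcs G" for u v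
  proof -
    let ?a = "iso_arcs f (u, v)"
    have "?a \<in> parcs H"
      using arg_cong[OF f(2), of arcs] uv by (auto simp: arcs_app_iso)
    moreover have "fst = iso_tail f" "snd = iso_head f"
      using arg_cong[OF f(2), of tail] arg_cong[OF f(2), of head] by (simp_all add: tail_app_iso head_app_iso)
    then have "?a = (iso_verts f u, iso_verts f v)"
      using f(1) uv by (auto simp: pre_digraph.digraph_isomorphism_def prod_eq_iff)
    ultimately show ?thesis by simp
  qed
  then show ?thesis using that by blast
qed

text \<open>Three pairwise disjoint 2-subsets would need six points.\<close>

lemma petersen_triangle_free:
  assumes "(S, T) \<in> parcs petersen" "(T, U) \<in> parcs petersen" "(U, S) \<in> parcs petersen"
  shows False
proof -
  have V: "S \<subseteq> {0..<5}" "card S = 2" "T \<subseteq> {0..<5}" "card T = 2" "U \<subseteq> {0..<5}" "card U = 2"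
    and disj: "S \<inter> T = {}" "T \<inter> U = {}" "U \<inter> S = {}"
    using assms by (auto simp: petersen_def Let_def)
  have fin: "finite S" "finite T" "finite U" using V by (auto intro: finite_subset)
  have "card (S \<union> T \<union> U) = 6"
    using V fin disj by (subst card_Un_disjoint) (auto simp: card_Un_disjoint)
  moreover have "card (S \<union> T \<union> U) \<le> card {0..<5::nat}" using V by (intro card_mono) auto
  ultimately show False by simp
qed

lemma petersen_mate_not_iso: "\<not> graph_iso petersen_mate petersen"
proof
  assume "graph_iso petersen_mate petersen"
  then obtain h where h: "\<And>u v. (u, v) \<in> parcs petersen_mate \<Longrightarrow> (h u, h v) \<in> parcs petersen"
    by (rule graph_iso_imp_hom) blast
  have "({i}, {j}) \<in> parcs petersen_mate" if "i < 10" "j \<in> set (petersen_mate_adj_list ! i)" for i j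
    using that by (auto simp: petersen_mate_def labelled_graph_def petersen_mate_adj_list_def)
  from this[of 0 1] this[of 1 2] this[of 2 0] show False
    using petersen_triangle_free[OF h h h, of "{0}" "{1}" "{2}"] by (simp add: petersen_mate_adj_list_def)
qed

theorem theorem3p7:
  shows "petersen \<in> regular_graphs 3 10
    \<and> \<not> eso_unique (regular_graphs 3 10) petersen
    \<and> (\<forall>H :: 'a pair_pre_digraph. H \<in> regular_graphs 3 10 \<longrightarrow> eso_energy H \<le> eso_energy petersen)"
  unfolding eso_unique_def eso_equivalent_def
  using petersen_regular petersen_mate_regular petersen_mate_not_iso petersen_energy petersen_mate_energy cubic_energy_le
  by metis

end
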